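(* Assume that the kernel $K_k$ has a compact support and that $\rho_a$ is $k$-times continuously differentiable in a neighborhood of $\psi_a(\xi)$ for some $\xi>0$. Then, as $n\to\infty$ and $h=h(n)\to0$, $$\mathbb{E}\left[\widehat\eta_{k,n,h,a}(\xi)\right]=\rho_a^{(k)}(\psi_a(\xi))+\mu_m(K_k)\,\frac{h^{m-k}}{m!}\,\rho_a^{(m)}(\psi_a(\xi))+O(h^{m-k+1}),$$ and $$\operatorname{Var}\left[\widehat\eta_{k,n,h,a}(\xi)\right]\sim\frac{g(\xi)\,\|K_k\|_2^2}{n\,h^{2k+1}\,s_d}.$$
   Context: Let $d\ge 1$ be an integer, $\boldsymbol\mu\in\mathbb{R}^d$, $\boldsymbol\Sigma$ a positive definite $d\times d$ matrix (both known), and $g:\mathbb{R}_+\to\mathbb{R}_+$ a function such that $f(\mathbf{x})=|\boldsymbol\Sigma|^{-1/2}g\big((\mathbf{x}-\boldsymbol\mu)^\top\boldsymbol\Sigma^{-1}(\mathbf{x}-\boldsymbol\mu)\big)$ is a probability density on $\mathbb{R}^d$. Let $\mathbf{X}_1,\dots,\mathbf{X}_n$ be i.i.d. with density $f$ and let $\xi_i:=(\mathbf{X}_i-\boldsymbol\mu)^\top\boldsymbol\Sigma^{-1}(\mathbf{X}_i-\boldsymbol\mu)$. For $a>0$ let $\psi_a(\xi):=-a+(a^{d/2}+\xi^{d/2})^{2/d}$, and for $\xi>0$ let $z_a(\xi):=\xi^{(d-2)/2}g(\xi)/\psi_a'(\xi)$ and $\rho_a:=z_a\circ\psi_a^{-1}$.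 Let $s_d:=\pi^{d/2}/\Gamma(d/2)$, where $\Gamma$ is the Gamma function. Fix two integers $k\ge0$ and $m$ such that $m\ge k+2$ and $m-k$ is even. $K_k$ is a kernel function of order $(k,m)$, i.e. $\int K_k(x)x^j\,dx$ equals $0$ for $j=0,1,\dots,k-1,k+1,\dots,m-1$, equals $(-1)^k k!$ for $j=k$, and equals $\mu_m(K_k)\neq0$ for $j=m$. Write $\|K_k\|_2^2=\int_{\mathbb{R}}K_k(w)^2\,dw$. For a bandwidth $h=h(n)>0$, the estimator is $$\widehat\eta_{k,n,h,a}(\xi)=\frac{1}{n h^{k+1}s_d}\sum_{i=1}^n\left[K_k\left(\frac{\psi_a(\xi)-\psi_a(\xi_i)}{h}\right)+K_k\left(\frac{\psi_a(\xi)+\psi_a(\xi_i)}{h}\right)\right].$$ Here $u\sim v$ means $u/v\to1$.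
   Formalization: The bias expansion assumes ρ_a is (m+1)-times continuously differentiable near ψ_a(ξ) and its h^{m-k} term carries a factor (-1)^m; in the variance, g(ξ) is replaced by z_a(ξ), and g(ξ)>0 is assumed. *)

theory Defs
  imports "HOL-Probability.Probability" "HOL-Library.Landau_Symbols"
begin

definition pos_def_matrix :: "real ^ 'd ^ 'd \<Rightarrow> bool" where
  "pos_def_matrix A \<longleftrightarrow> transpose A = A \<and> (\<forall>x. x \<noteq> 0 \<longrightarrow> 0 < x \<bullet> (A *v x))"

definition mahalanobis_sq :: "real ^ 'd \<Rightarrow> real ^ 'd ^ 'd \<Rightarrow> real ^ 'd \<Rightarrow> real" where
  "mahalanobis_sq \<mu> \<Sigma> x = (x - \<mu>) \<bullet> (matrix_inv \<Sigma> *v (x - \<mu>))"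

definition elliptical_density ::
    "real ^ 'd \<Rightarrow> real ^ 'd ^ 'd \<Rightarrow> (real \<Rightarrow> real) \<Rightarrow> real ^ 'd \<Rightarrow> real" where
  "elliptical_density \<mu> \<Sigma> g x = det \<Sigma> powr (- 1 / 2) * g (mahalanobis_sq \<mu> \<Sigma> x)"

definition prob_density :: "('a :: euclidean_space \<Rightarrow> real) \<Rightarrow> bool" where
  "prob_density f \<longleftrightarrow> f \<in> borel_measurable borel \<and> (\<forall>x. 0 \<le> f x) \<and>
     (\<integral>\<^sup>+ x. ennreal (f x) \<partial>lborel) = 1"

definition s_const :: "nat \<Rightarrow> real" where
  "s_const d = pi powr (real d / 2) / Gamma (real d / 2)"

definition psi :: "nat \<Rightarrow> real \<Rightarrow> real \<Rightarrow> real" where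
  "psi d a \<xi> = - a + (a powr (real d / 2) + \<xi> powr (real d / 2)) powr (2 / real d)"

definition z_fun :: "nat \<Rightarrow> (real \<Rightarrow> real) \<Rightarrow> real \<Rightarrow> real \<Rightarrow> real" where
  "z_fun d g a \<xi> = \<xi> powr ((real d - 2) / 2) * g \<xi> / deriv (psi d a) \<xi>"

text \<open>For \<open>a > 0\<close> and \<open>d \<ge> 1\<close>, \<open>psi d a\<close> is an increasing bijection of the open half-line
  onto itself, so \<open>rho\<close> is meaningful at positive arguments; elsewhere it is unspecified.\<close>

definition rho :: "nat \<Rightarrow> (real \<Rightarrow> real) \<Rightarrow> real \<Rightarrow> real \<Rightarrow> real" where
  "rho d g a = z_fun d g a \<circ> the_inv_into {0<..} (psi d a)"

text \<open>Continuity of the derivatives of order \<open>< k\<close> is implied by their differentiability.\<close>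

definition cont_diff_near :: "nat \<Rightarrow> (real \<Rightarrow> real) \<Rightarrow> real \<Rightarrow> bool" where
  "cont_diff_near k f x \<longleftrightarrow> (\<exists>U. open U \<and> x \<in> U \<and>
     (\<forall>j<k. \<forall>y\<in>U. (deriv ^^ j) f differentiable (at y)) \<and>
     continuous_on U ((deriv ^^ k) f))"

definition kernel_moment :: "nat \<Rightarrow> (real \<Rightarrow> real) \<Rightarrow> real" where
  "kernel_moment j K = (LINT x|lborel. K x * x ^ j)"

definition kernel_of_order :: "nat \<Rightarrow> nat \<Rightarrow> (real \<Rightarrow> real) \<Rightarrow> bool" where
  "kernel_of_order k m K \<longleftrightarrow>
     (\<forall>j\<le>m. integrable lborel (\<lambda>x. K x * x ^ j)) \<and>
     (\<forall>j<m. j \<noteq> k \<longrightarrow> kernel_moment j K = 0) \<and>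
     kernel_moment k K = (- 1) ^ k * fact k \<and>
     kernel_moment m K \<noteq> 0"

definition eta_hat ::
    "real ^ 'd \<Rightarrow> real ^ 'd ^ 'd \<Rightarrow> nat \<Rightarrow> (real \<Rightarrow> real) \<Rightarrow> real \<Rightarrow> (nat \<Rightarrow> 'w \<Rightarrow> real ^ 'd) \<Rightarrow>
     nat \<Rightarrow> real \<Rightarrow> real \<Rightarrow> 'w \<Rightarrow> real" where
  "eta_hat \<mu> \<Sigma> k K a X n h \<xi> \<omega> =
     1 / (real n * h ^ (k + 1) * s_const CARD('d)) *
     (\<Sum>i=1..n.
        K ((psi CARD('d) a \<xi> - psi CARD('d) a (mahalanobis_sq \<mu> \<Sigma> (X i \<omega>))) / h) +
        K ((psi CARD('d) a \<xi> + psi CARD('d) a (mahalanobis_sq \<mu> \<Sigma> (X i \<omega>))) / h))"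

text \<open>In particular \<open>z_fun d g a\<close> coincides on positive arguments with \<open>g\<close> when \<open>d = 2\<close>, but not in other dimensions.\<close>

lemma z_fun_eq:
  assumes "d \<ge> 1" "a > 0" "\<xi> > 0"
  shows "z_fun d g a \<xi> =
    g \<xi> * (a powr (real d / 2) + \<xi> powr (real d / 2)) powr ((real d - 2) / real d)"
proof -
  define p where "p = real d / 2"
  define S where "S = a powr p + \<xi> powr p"
  have p: "p > 0" and inv: "2 / real d = 1 / p" using assms by (simp_all add: p_def)
  have S: "S > 0" using assms by (simp add: S_def add_pos_pos)
  have inner: "((\<lambda>t. a powr p + t powr p) has_real_derivative p * \<xi> powr (p - 1)) (at \<xi>)"
    using DERIV_add[OF DERIV_const has_real_derivative_powr[OF assms(3), of p]] by simp
  have outer: "((\<lambda>s. s powr (1 / p)) has_real_derivative 1 / p * S powr (1 / p - 1))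
      (at (a powr p + \<xi> powr p))"
    using has_real_derivative_powr[OF S, of "1 / p"] by (simp add: S_def)
  note DERIV_chain2[OF outer inner]
  from DERIV_add[OF DERIV_const this, of "- a"]
  have "(psi d a has_real_derivative 1 / p * S powr (1 / p - 1) * (p * \<xi> powr (p - 1))) (at \<xi>)"
    unfolding psi_def inv p_def[symmetric] by simp
  hence deriv: "deriv (psi d a) \<xi> = S powr (1 / p - 1) * \<xi> powr (p - 1)"
    using p by (simp add: DERIV_imp_deriv)
  have e1: "(real d - 2) / 2 = p - 1" and e2: "(real d - 2) / real d = - (1 / p - 1)"
    using assms by (simp_all add: p_def diff_divide_distrib)
  have "\<xi> powr (p - 1) > 0" "S powr (1 / p - 1) > 0" using assms S by simp_all
  thus ?thesis
    unfolding z_fun_def deriv e1 e2 p_def[symmetric] S_def[symmetric] powr_minus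
    by (simp add: divide_inverse)
qed

end

(*
  V = psi_a(xi) has density s_d rho_a on the half-line: an ellipsoid
  {x. mahalanobis_sq mu Sigma x <= t} is a linear image of a ball (Gram-Schmidt for the form
  given by the inverse of Sigma), so the region V <= v has Lebesgue measure proportional to
  (v + a)^(d/2) - a^(d/2), while g is a function of V.  Since V >= 0 and psi_a(xi) > 0, the
  reflected kernel term vanishes once h is small, and the moments of one summand become
  s_d h times the integral of L(w) rho_a(y - h w) with L = K or K^2: Taylor expansion against the
  vanishing moments of K gives the bias, and continuity of rho_a at y gives the variance.
*)

theory Submission
  imports Defs
begin

text \<open>The volume of an ellipsoid is linear in \<open>t powr (d / 2)\<close>, and
  \<open>psi\<close> is built so that \<open>(psi d a t + a) powr (d / 2)\<close> is this power plus
  a constant. The law of V can therefore be read off a distribution function, without polar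
  coordinates: Lebesgue measure itself is pushed forward, and the density of X is carried along as a
  factor. Two partially specified functions shape the rest. \<open>g\<close> is constrained only
  through the composite density, so it may fail to be measurable at negative arguments and is
  replaced by a Borel function that agrees with it elsewhere. \<open>rho\<close> is unspecified at
  nonpositive arguments, so integrals use a truncation that equals \<open>rho\<close> near the point
  of interest. As \<open>rho\<close> may also be unbounded near 0, all kernel estimates are local,
  and integrability of the estimator holds only eventually in n.\<close>

section \<open>Volume of linear images\<close>

lemma det_shear_cart:
  fixes m n :: "'n::finite"
  assumes "m \<noteq> n"
  shows "det (matrix (\<lambda>x. \<chi> i. if i = m then x $ m + x $ n else x $ i) :: real^'n^'n) = 1"
proof -
  have "(matrix (\<lambda>x. \<chi> i. if i = m then x $ m + x $ n else x $ i) :: real^'n^'n)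
      = (\<chi> k. if k = m then row m (mat 1) + 1 *s row n (mat 1) else row k (mat 1))"
    by (auto simp: matrix_def vec_eq_iff row_def mat_def axis_def)
  then show ?thesis
    using det_row_operation[OF assms, of "mat 1 :: real^'n^'n" 1] by simp
qed

lemma measure_shear_cbox:
  fixes a b :: "real^'n" and m n :: 'n
  defines "h \<equiv> (\<lambda>x::real^'n. \<chi> i. if i = m then x $ m + x $ n else x $ i)"
  assumes "m \<noteq> n"
  shows "measure lebesgue (h ` cbox a b) = measure lebesgue (cbox a b)"
proof (cases "cbox a b = {}")
  case False
  \<comment> \<open>The volume formula for a sheared box asks for a nonnegative \<open>n\<close>-th
    lower coordinate. This translation makes that coordinate 0, and by additivity \<open>h\<close>
    turns it into the translation by \<open>h t\<close>.\<close>
  define t where "t = axis n (- a $ n)"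
  have lin: "h (t + x) = h t + h x" for x
    by (auto simp: h_def vec_eq_iff)
  have box: "(+) t ` cbox a b = cbox (t + a) (t + b)"
    by (rule cbox_translation[symmetric])
  have "measure lebesgue (h ` cbox a b) = measure lebesgue ((+) (h t) ` h ` cbox a b)"
    by (rule measure_translation[symmetric])
  also have "(+) (h t) ` h ` cbox a b = h ` cbox (t + a) (t + b)"
    by (simp add: image_comp o_def lin flip: box)
  also have "measure lebesgue \<dots> = measure lebesgue (cbox (t + a) (t + b))"
    unfolding h_def using False box \<open>m \<noteq> n\<close>
    by (intro measure_shear_interval) (auto simp: t_def)
  also have "\<dots> = measure lebesgue (cbox a b)"
    unfolding box[symmetric] by (rule measure_translation)
  finally show ?thesis .
qed simp

text \<open>A coordinate swap is an involution, so it maps the box onto the box between the swapped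
  corners, and the product of the side lengths is only reindexed.\<close>

lemma measure_transpose_cbox:
  fixes a b :: "real^'n" and m n :: 'n
  defines "h \<equiv> (\<lambda>x::real^'n. \<chi> i. x $ Transposition.transpose m n i)"
  shows "measure lebesgue (h ` cbox a b) = measure lebesgue (cbox a b)"
proof (cases "cbox a b = {}")
  case False
  have inv: "h (h x) = x" for x by (simp add: h_def vec_eq_iff)
  have mem: "h x \<in> cbox (h a) (h b) \<longleftrightarrow> x \<in> cbox a b" for x
    unfolding mem_box_cart h_def vec_lambda_beta by (metis transpose_involutory)
  have eq: "h ` cbox a b = cbox (h a) (h b)"
  proof (rule set_eqI)
    show "x \<in> h ` cbox a b \<longleftrightarrow> x \<in> cbox (h a) (h b)" for x
      using mem[of "h x"] inv[of x] by (metis image_iff inv)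
  qed
  have "(\<Prod>i\<in>UNIV. h b $ i - h a $ i) = (\<Prod>i\<in>UNIV. b $ i - a $ i)"
    unfolding h_def vec_lambda_beta
    by (rule prod.reindex_bij_betw[where g="\<lambda>i. b $ i - a $ i"]) simp
  moreover have "cbox (h a) (h b) \<noteq> {}" using False eq by auto
  ultimately show ?thesis using False eq by (simp add: content_cbox_if_cart)
qed simp

lemma measure_linear_image_preserving:
  fixes h :: "'a::euclidean_space \<Rightarrow> 'a"
  assumes "linear h" and "\<And>a b. measure lebesgue (h ` cbox a b) = measure lebesgue (cbox a b)"
    and "S \<in> lmeasurable"
  shows "h ` S \<in> lmeasurable" and "measure lebesgue (h ` S) = measure lebesgue S"
proof -
  have "h ` S \<in> lmeasurable \<and> 1 * measure lebesgue S = measure lebesgue (h ` S)"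
    by (rule measure_linear_sufficient[OF assms(1,3)]) (simp only: assms(2) mult_1)
  then show "h ` S \<in> lmeasurable" and "measure lebesgue (h ` S) = measure lebesgue S" by auto
qed

text \<open>The library version of this formula is restricted to well-ordered index types.\<close>

proposition measure_linear_image_cart:
  fixes f :: "real^'n \<Rightarrow> real^'n"
  assumes "linear f" and "S \<in> lmeasurable"
  shows "f ` S \<in> lmeasurable \<and> measure lebesgue (f ` S) = \<bar>det (matrix f)\<bar> * measure lebesgue S"
proof -
  let ?P = "\<lambda>f :: real^'n \<Rightarrow> real^'n. \<forall>S\<in>lmeasurable.
    f ` S \<in> lmeasurable \<and> measure lebesgue (f ` S) = \<bar>det (matrix f)\<bar> * measure lebesgue S"
  have "?P f"
  \<comment> \<open>Volume factor and absolute determinant are both multiplicative under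
    composition. This leaves the elementary maps: those with a vanishing coordinate, coordinate
    scalings, swaps and shears.\<close>
  proof (rule induct_linear_elementary[OF \<open>linear f\<close>])
    fix f g :: "real^'n \<Rightarrow> real^'n"
    assume fg: "linear f" "linear g" and P: "?P f" "?P g"
    have det: "det (matrix (f \<circ> g)) = det (matrix f) * det (matrix g)"
      using matrix_compose[OF fg(2,1)] by (simp add: det_mul)
    show "?P (f \<circ> g)"
    proof
      fix S :: "(real^'n) set" assume "S \<in> lmeasurable"
      with P(2) have g: "g ` S \<in> lmeasurable"
        "measure lebesgue (g ` S) = \<bar>det (matrix g)\<bar> * measure lebesgue S" by auto
      show "(f \<circ> g) ` S \<in> lmeasurable \<and>
          measure lebesgue ((f \<circ> g) ` S) = \<bar>det (matrix (f \<circ> g))\<bar> * measure lebesgue S"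
        unfolding image_comp[symmetric] det abs_mult using bspec[OF P(1) g(1)] g(2) by simp
    qed
  next
    fix f :: "real^'n \<Rightarrow> real^'n" and i
    assume f: "linear f" and zero: "\<And>x. f x $ i = 0"
    \<comment> \<open>A missed vector makes \<open>f\<close> not onto, hence not injective in finite
      dimension: the determinant is 0 and every image is negligible.\<close>
    have "f x \<noteq> axis i 1" for x
      using zero[of x] by (metis axis_nth zero_neq_one)
    then have "\<not> inj f"
      using linear_injective_imp_surjective[OF f] by (metis surjD)
    moreover from this have "det (matrix f) = 0"
      using det_nz_iff_inj[OF f] by blast
    ultimately show "?P f"
      using negligible_linear_singular_image[OF f] by (simp add: negligible_iff_measure)
  next
    fix c :: "'n \<Rightarrow> real"
    have "det (matrix (\<lambda>x::real^'n. \<chi> i. c i * x $ i)) = prod c UNIV"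
      by (subst det_diagonal) (auto simp: matrix_def axis_def)
    then show "?P (\<lambda>x. \<chi> i. c i * x $ i)"
      by (simp add: measurable_stretch measure_stretch)
  next
    fix m n :: 'n
    let ?h = "\<lambda>x::real^'n. \<chi> i. x $ Transposition.transpose m n i"
    have lin: "linear ?h" by (rule linearI) (simp_all add: vec_eq_iff)
    have "matrix ?h = (\<chi> i. mat 1 $ Transposition.transpose m n i)"
      by (auto simp: matrix_def mat_def axis_def vec_eq_iff)
    then have det: "\<bar>det (matrix ?h)\<bar> = 1"
      by (simp add: det_permute_rows permutes_swap_id sign_swap_id)
    show "?P ?h"
      using measure_linear_image_preserving[OF lin measure_transpose_cbox]
      unfolding det mult_1 by (intro ballI conjI)
  next
    fix m n :: 'n assume mn: "m \<noteq> n"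
    let ?h = "\<lambda>x::real^'n. \<chi> i. if i = m then x $ m + x $ n else x $ i"
    have lin: "linear ?h" by (rule linearI) (simp_all add: vec_eq_iff algebra_simps)
    show "?P ?h"
      using measure_linear_image_preserving[OF lin measure_shear_cbox[OF mn]]
      unfolding det_shear_cart[OF mn] abs_one mult_1 by (intro ballI conjI)
  qed
  with assms show ?thesis by blast
qed

section \<open>Frames of a positive definite form and volumes of ellipsoids\<close>

text \<open>Fewer than \<open>CARD('n)\<close> vectors cannot span, so a vector outside their span
  remains nonzero after its \<open>A\<close>-projections are subtracted, and it can be normalised.
  Linear independence need not be tracked: the cardinality of \<open>B\<close> alone bounds the
  dimension of its span.\<close>

lemma pos_def_partial_frame:
  fixes A :: "real^'n^'n"
  assumes A: "pos_def_matrix A" and "k \<le> CARD('n)"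
  shows "\<exists>B. finite B \<and> card B = k \<and> (\<forall>u\<in>B. \<forall>v\<in>B. u \<bullet> (A *v v) = of_bool (u = v))"
  using assms(2)
proof (induction k)
  case (Suc k)
  then obtain B where B: "finite B" "card B = k"
    and orth: "\<And>u v. u \<in> B \<Longrightarrow> v \<in> B \<Longrightarrow> u \<bullet> (A *v v) = of_bool (u = v)" by auto
  have sym: "u \<bullet> (A *v v) = v \<bullet> (A *v u)" for u v
    using A by (metis dot_lmul_matrix inner_commute pos_def_matrix_def transpose_matrix_vector)
  have "dim (span B) \<le> k" using dim_le_card[of B B] B by (simp add: span_superset)
  then have "span B \<noteq> UNIV" using Suc.prems by (metis dim_UNIV  DIM_cart DIM_real mult.right_neutral not_less_eq_eq)
  then obtain x where x: "x \<notin> span B" by auto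
  define w where "w = x - (\<Sum>b\<in>B. (x \<bullet> (A *v b)) *\<^sub>R b)"
  have w0: "w \<noteq> 0"
  proof
    assume "w = 0"
    then have "x = (\<Sum>b\<in>B. (x \<bullet> (A *v b)) *\<^sub>R b)" by (simp add: w_def)
    also have "\<dots> \<in> span B" by (intro span_sum span_mul span_base)
    finally show False using x by simp
  qed
  have wB: "w \<bullet> (A *v b) = 0" if "b \<in> B" for b
  proof -
    have "(\<Sum>c\<in>B. (x \<bullet> (A *v c)) *\<^sub>R c) \<bullet> (A *v b) = (\<Sum>c\<in>B. (x \<bullet> (A *v c)) * of_bool (c = b))"
      using that by (simp add: inner_sum_left orth)
    also have "\<dots> = x \<bullet> (A *v b)"
      using B that by (simp add: of_bool_def if_distrib sum.delta cong: if_cong)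
    finally show ?thesis by (simp add: w_def inner_diff_left)
  qed
  define q where "q = w \<bullet> (A *v w)"
  have q: "q > 0" using A w0 by (auto simp: pos_def_matrix_def q_def)
  define v where "v = (1 / sqrt q) *\<^sub>R w"
  have vv: "v \<bullet> (A *v v) = 1"
    using q by (simp add: v_def matrix_vector_mult_scaleR q_def[symmetric])
  have vB: "v \<bullet> (A *v b) = 0" "b \<bullet> (A *v v) = 0" if "b \<in> B" for b
    using wB[OF that] sym[of b v] by (simp_all add: v_def)
  have "v \<notin> B" using vB(1) vv by force
  then show ?case
    using B orth vv vB by (intro exI[of _ "insert v B"]) auto
qed (intro exI[of _ "{}"], simp)

text \<open>The columns of \<open>T\<close> are the frame vectors. The substitution
  \<open>x = \<mu> + T *v y\<close> then turns the form of \<open>A\<close> into the squared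
  Euclidean norm of \<open>y\<close>.\<close>

lemma pos_def_frame:
  fixes A :: "real^'n^'n"
  assumes "pos_def_matrix A"
  obtains T :: "real^'n^'n" where "transpose T ** (A ** T) = mat 1"
proof -
  obtain B where B: "finite B" "card B = CARD('n)"
    and orth: "\<And>u v. u \<in> B \<Longrightarrow> v \<in> B \<Longrightarrow> u \<bullet> (A *v v) = of_bool (u = v)"
    using pos_def_partial_frame[OF assms, of "CARD('n)"] by auto
  obtain e where e: "bij_betw e (UNIV :: 'n set) B"
    using finite_same_card_bij[of "UNIV :: 'n set" B] B by auto
  define T :: "real^'n^'n" where "T = (\<chi> i j. e j $ i)"
  have "(transpose T ** (A ** T)) $ i $ j = e i \<bullet> (A *v e j)" for i j
    by (simp add: matrix_matrix_mult_def transpose_def T_def inner_vec_def matrix_vector_mult_def)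
  also have "e i \<bullet> (A *v e j) = of_bool (i = j)" for i j
    using e orth[of "e i" "e j"] by (auto simp: bij_betw_def inj_def)
  finally have "transpose T ** (A ** T) = mat 1"
    by (simp add: vec_eq_iff mat_def)
  then show thesis by (rule that)
qed

lemma matrix_inv_inverse:
  fixes A :: "real^'n^'n"
  assumes "invertible A"
  shows "A ** matrix_inv A = mat 1" and "matrix_inv A ** A = mat 1"
  using someI_ex[OF assms[unfolded invertible_def]] by (simp_all add: matrix_inv_def)

text \<open>Positivity makes the kernel trivial; for \<open>x = \<Sigma> *v u\<close> the form of
  the inverse at \<open>x\<close> is the form of \<open>\<Sigma>\<close> at
  \<open>u\<close>.\<close>

lemma pos_def_matrix_inv:
  fixes \<Sigma> :: "real^'n^'n"
  assumes "pos_def_matrix \<Sigma>"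
  shows "invertible \<Sigma>" and "pos_def_matrix (matrix_inv \<Sigma>)"
proof -
  have pos: "x \<noteq> 0 \<Longrightarrow> 0 < x \<bullet> (\<Sigma> *v x)" and tr: "transpose \<Sigma> = \<Sigma>" for x
    using assms by (auto simp: pos_def_matrix_def)
  have "\<Sigma> *v x = 0 \<longrightarrow> x = 0" for x using pos[of x] by force
  then have "\<exists>B. B ** \<Sigma> = mat 1" by (simp add: matrix_left_invertible_ker)
  then show inv: "invertible \<Sigma>" by (simp add: invertible_left_inverse)
  then have AS: "\<Sigma> ** matrix_inv \<Sigma> = mat 1" "matrix_inv \<Sigma> ** \<Sigma> = mat 1"
    by (rule matrix_inv_inverse)+
  have "transpose (matrix_inv \<Sigma>) ** \<Sigma> = mat 1"
    using AS(1) tr by (metis matrix_transpose_mul transpose_mat)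
  then have "transpose (matrix_inv \<Sigma>) = matrix_inv \<Sigma>"
    using AS by (metis matrix_mul_assoc matrix_mul_lid matrix_mul_rid)
  moreover have "0 < x \<bullet> (matrix_inv \<Sigma> *v x)" if "x \<noteq> 0" for x
  proof -
    define u where "u = matrix_inv \<Sigma> *v x"
    have x: "x = \<Sigma> *v u" by (simp add: u_def matrix_vector_mul_assoc AS)
    with that have "u \<noteq> 0" by auto
    from pos[OF this] show ?thesis
      unfolding u_def[symmetric] using x by (simp add: inner_commute)
  qed
  ultimately show "pos_def_matrix (matrix_inv \<Sigma>)" by (simp add: pos_def_matrix_def)
qed

lemma continuous_on_mahalanobis_sq: "continuous_on S (mahalanobis_sq \<mu> \<Sigma>)"
  unfolding mahalanobis_sq_def
  by (intro continuous_intros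
      continuous_on_compose2[OF matrix_vector_mult_linear_continuous_on[of UNIV]]) auto

lemma borel_measurable_mahalanobis_sq [measurable]: "mahalanobis_sq \<mu> \<Sigma> \<in> borel_measurable borel"
  by (intro borel_measurable_continuous_onI continuous_on_mahalanobis_sq)

text \<open>One frame \<open>T\<close> for the inverse of \<open>\<Sigma>\<close> gives both claims.
  The ellipsoid is the image under \<open>T\<close>, translated by \<open>\<mu>\<close>, of the ball
  of radius \<open>sqrt t\<close>, and taking determinants in the frame identity yields
  \<open>det \<Sigma> = (det T)\<^sup>2\<close>.\<close>

lemma emeasure_mahalanobis_le:
  fixes \<Sigma> :: "real^'d^'d"
  assumes \<Sigma>: "pos_def_matrix \<Sigma>" and "t \<ge> 0"
  shows "det \<Sigma> > 0"
    and "emeasure lborel {x. mahalanobis_sq \<mu> \<Sigma> x \<le> t}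
       = ennreal (sqrt (det \<Sigma>) * (unit_ball_vol (real CARD('d)) * sqrt t ^ CARD('d)))"
proof -
  let ?A = "matrix_inv \<Sigma>"
  obtain T :: "real^'d^'d" where T: "transpose T ** (?A ** T) = mat 1"
    using pos_def_frame pos_def_matrix_inv(2)[OF \<Sigma>] by blast
  have "?A ** \<Sigma> = mat 1" using pos_def_matrix_inv(1)[OF \<Sigma>] by (rule matrix_inv_inverse)
  then have dA: "det ?A * det \<Sigma> = 1" by (metis det_I det_mul)
  have dT: "det T * (det ?A * det T) = 1" using T by (metis det_I det_mul det_transpose)
  have "det \<Sigma> = det \<Sigma> * (det T * (det ?A * det T))" by (simp add: dT)
  also have "\<dots> = (det ?A * det \<Sigma>) * (det T)\<^sup>2" by (simp add: power2_eq_square)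
  finally have "det \<Sigma> = (det T)\<^sup>2" by (simp add: dA)
  moreover have dT0: "det T \<noteq> 0" using dT by auto
  ultimately show "det \<Sigma> > 0" by simp
  have dS: "sqrt (det \<Sigma>) = \<bar>det T\<bar>" by (simp add: \<open>det \<Sigma> = (det T)\<^sup>2\<close>)
  have mah: "mahalanobis_sq \<mu> \<Sigma> (\<mu> + T *v y) = y \<bullet> y" for y
  proof -
    have "mahalanobis_sq \<mu> \<Sigma> (\<mu> + T *v y) = (T *v y) \<bullet> ((?A ** T) *v y)"
      by (simp add: mahalanobis_sq_def matrix_vector_mul_assoc)
    also have "\<dots> = y \<bullet> ((transpose T ** (?A ** T)) *v y)"
      by (metis dot_lmul_matrix matrix_vector_mul_assoc transpose_matrix_vector transpose_transpose)
    finally show ?thesis by (simp add: T)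
  qed
  have Tinv: "invertible T" using dT0 by (simp add: invertible_det_nz)
  have EI: "{x. mahalanobis_sq \<mu> \<Sigma> x \<le> t} = (+) \<mu> ` (*v) T ` cball 0 (sqrt t)" (is "?E = ?I")
  proof (rule set_eqI)
    fix x
    define y where "y = matrix_inv T *v (x - \<mu>)"
    have x: "x = \<mu> + T *v y"
      using matrix_inv_inverse[OF Tinv] by (simp add: y_def matrix_vector_mul_assoc)
    have "y' = y" if "\<mu> + T *v y' = x" for y'
      using that matrix_inv_inverse[OF Tinv] by (auto simp: y_def matrix_vector_mul_assoc)
    then have "x \<in> ?I \<longleftrightarrow> norm y \<le> sqrt t" using x by (auto simp: image_iff)
    also have "\<dots> \<longleftrightarrow> y \<bullet> y \<le> t"
      using \<open>t \<ge> 0\<close> by (simp add: norm_eq_sqrt_inner)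
    finally show "x \<in> ?E \<longleftrightarrow> x \<in> ?I" using mah[of y] x by simp
  qed
  have I: "?I \<in> lmeasurable"
    "measure lebesgue ?I = \<bar>det T\<bar> * measure lebesgue (cball (0::real^'d) (sqrt t))"
    using measure_linear_image_cart[of "(*v) T" "cball 0 (sqrt t)"]
    by (simp_all add: measurable_translation measure_translation)
  have ball: "measure lebesgue (cball (0::real^'d) (sqrt t)) = unit_ball_vol (real CARD('d)) * sqrt t ^ CARD('d)"
    using content_cball[of "sqrt t" "0::real^'d"] \<open>t \<ge> 0\<close> by simp
  have "?E \<in> sets lborel" by simp
  then have "emeasure lborel ?E = emeasure lebesgue ?I" unfolding EI[symmetric] by simp
  also have "\<dots> = ennreal (measure lebesgue ?I)"
    using I(1) by (rule emeasure_eq_measure2)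
  finally show "emeasure lborel ?E
       = ennreal (sqrt (det \<Sigma>) * (unit_ball_vol (real CARD('d)) * sqrt t ^ CARD('d)))"
    unfolding I(2) ball dS .
qed

section \<open>The transformation psi and its inverse\<close>

text \<open>The inverse inside \<open>rho\<close> is tied to the open half-line, while distribution
  functions also involve the endpoint 0; the closed form covers both. Being a \<open>powr\<close>,
  it is nonnegative at every real argument.\<close>

definition psi_inv :: "nat \<Rightarrow> real \<Rightarrow> real \<Rightarrow> real" where
  "psi_inv d a v = ((v + a) powr (real d / 2) - a powr (real d / 2)) powr (2 / real d)"

context
  fixes d :: nat and a :: real
  assumes d: "d \<ge> 1" and a: "a > 0"
begin

lemma psi_inv_powr:
  assumes "v \<ge> 0"
  shows "psi_inv d a v powr (real d / 2) = (v + a) powr (real d / 2) - a powr (real d / 2)"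
proof -
  have "a powr (real d / 2) \<le> (v + a) powr (real d / 2)"
    using assms a by (intro powr_mono2) auto
  then show ?thesis using d by (simp add: psi_inv_def powr_powr)
qed

text \<open>After adding \<open>a\<close> and raising to the power \<open>d / 2\<close>, both sides
  compare the same monotone powers. This equivalence is what turns sublevel sets of V into
  ellipsoids.\<close>

lemma psi_le_iff:
  assumes "t \<ge> 0" "v \<ge> 0"
  shows "psi d a t \<le> v \<longleftrightarrow> t \<le> psi_inv d a v"
proof -
  define p where "p = real d / 2"
  have p: "p > 0" and inv: "2 / real d = 1 / p" using d by (simp_all add: p_def)
  have le_iff: "x powr p \<le> y powr p \<longleftrightarrow> x \<le> y" if "x \<ge> 0" "y \<ge> 0" for x y
    using that p by (meson linorder_not_le powr_less_mono2 powr_mono2 less_imp_le)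
  have pos: "a powr p + t powr p \<ge> 0" by simp
  have "psi d a t \<le> v \<longleftrightarrow> (a powr p + t powr p) powr (1 / p) \<le> v + a"
    by (simp add: psi_def inv p_def[symmetric] algebra_simps)
  also have "\<dots> \<longleftrightarrow> a powr p + t powr p \<le> (v + a) powr p"
    using le_iff[of "(a powr p + t powr p) powr (1 / p)" "v + a"] assms a p
    by (simp add: powr_powr)
  also have "\<dots> \<longleftrightarrow> t powr p \<le> psi_inv d a v powr p"
    using psi_inv_powr[OF assms(2)] by (auto simp: p_def[symmetric])
  also have "\<dots> \<longleftrightarrow> t \<le> psi_inv d a v"
    using assms by (intro le_iff) (auto simp: psi_inv_def)
  finally show ?thesis .
qed

lemma psi_psi_inv:
  assumes "v \<ge> 0"
  shows "psi d a (psi_inv d a v) = v"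
  using assms d a unfolding psi_def psi_inv_powr[OF assms] by (simp add: powr_powr)

lemma psi_inv_psi:
  assumes "t \<ge> 0"
  shows "psi_inv d a (psi d a t) = t"
  using assms d a by (simp add: psi_def psi_inv_def powr_powr)

lemma psi_0: "psi d a 0 = 0"
  using d a by (simp add: psi_def powr_powr)

lemma psi_pos:
  assumes "t > 0"
  shows "psi d a t > 0"
  using psi_le_iff[of t 0] assms d a by (simp add: psi_inv_def)

lemma psi_nonneg:
  assumes "t \<ge> 0"
  shows "psi d a t \<ge> 0"
  using psi_pos[of t] psi_0 assms by (cases "t = 0") auto

lemma inj_on_psi: "inj_on (psi d a) {0<..}"
  by (rule inj_on_inverseI[of _ "psi_inv d a"]) (simp add: psi_inv_psi)

lemma rho_psi:
  assumes "\<xi> > 0"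
  shows "rho d g a (psi d a \<xi>) = z_fun d g a \<xi>"
  using assms by (simp add: rho_def the_inv_into_f_f[OF inj_on_psi])

text \<open>By \<open>z_fun_eq\<close>, division by the derivative of \<open>psi\<close> leaves a
  power of \<open>a powr (d / 2) + \<xi> powr (d / 2)\<close>, which is
  \<open>(v + a) powr (d / 2)\<close> at \<open>\<xi> = psi_inv d a v\<close>. The remaining power
  of \<open>v + a\<close> is the one that differentiating the volume produces.\<close>

lemma rho_eq:
  assumes "v > 0"
  shows "rho d g a v = g (psi_inv d a v) * (v + a) powr (real d / 2 - 1)"
proof -
  have t: "psi_inv d a v > 0"
    using assms psi_le_iff[of 0 v] psi_psi_inv[of v] psi_0
    by (metis less_eq_real_def order.refl psi_inv_def powr_ge_zero)
  have "the_inv_into {0<..} (psi d a) v = psi_inv d a v"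
    using t assms by (intro the_inv_into_f_eq[OF inj_on_psi]) (auto simp: psi_psi_inv)
  moreover have "((v + a) powr (real d / 2)) powr ((real d - 2) / real d) = (v + a) powr (real d / 2 - 1)"
    using d by (simp add: powr_powr diff_divide_distrib algebra_simps)
  ultimately show ?thesis
    using z_fun_eq[OF d a t, of g] psi_inv_powr[of v] assms by (simp add: rho_def)
qed

end

section \<open>The law of V\<close>

text \<open>This is the functional equation of Gamma. The divisor \<open>d / 2\<close> cancels
  against the exponent when \<open>(v + a) powr (d / 2)\<close> is differentiated, which leaves
  \<open>s_const d\<close> as the constant of the density.\<close>

lemma unit_ball_vol_eq_s_const:
  assumes "d \<ge> 1"
  shows "unit_ball_vol (real d) = s_const d / (real d / 2)"
proof -
  have "real d / 2 \<notin> \<int>\<^sub>\<le>\<^sub>0" using assms by (auto elim!: nonpos_Ints_cases)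
  then have "Gamma (real d / 2 + 1) = real d / 2 * Gamma (real d / 2)" by (rule Gamma_plus1)
  then show ?thesis unfolding unit_ball_vol_def s_const_def by (simp only: divide_divide_eq_left mult.commute)
qed

lemma s_const_pos:
  assumes "d \<ge> 1"
  shows "s_const d > 0"
  using assms by (simp add: s_const_def Gamma_real_pos)

lemma borel_measurable_psi [measurable]: "psi d a \<in> borel_measurable borel"
  unfolding psi_def by measurable

lemma borel_measurable_psi_inv [measurable]: "psi_inv d a \<in> borel_measurable borel"
  unfolding psi_inv_def by measurable

lemma mahalanobis_sq_nonneg:
  assumes "pos_def_matrix \<Sigma>"
  shows "mahalanobis_sq \<mu> \<Sigma> x \<ge> 0"
  using pos_def_matrix_inv(2)[OF assms]
  by (cases "x = \<mu>") (auto simp: mahalanobis_sq_def pos_def_matrix_def less_imp_le)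

lemma nn_integral_shifted_powr:
  fixes a p v :: real
  assumes "a > 0" "p > 0" "v \<ge> 0" "c \<ge> 0"
  shows "(\<integral>\<^sup>+u. ennreal (c * (u + a) powr (p - 1)) * indicator {0..v} u \<partial>lborel)
    = ennreal (c / p * ((v + a) powr p - a powr p))"
proof -
  have "(\<integral>\<^sup>+u. ennreal (c * (u + a) powr (p - 1)) * indicator {0..v} u \<partial>lborel)
    = ennreal (c / p * (v + a) powr p - c / p * (0 + a) powr p)"
    using assms
    by (intro nn_integral_FTC_Icc) (auto intro!: derivative_eq_intros)
  then show ?thesis by (simp add: right_diff_distrib)
qed

lemma emeasure_psi_mahalanobis_le:
  fixes \<Sigma> :: "real^'d^'d"
  assumes \<Sigma>: "pos_def_matrix \<Sigma>" and a: "a > 0" and v: "v \<ge> 0"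
  shows "emeasure lborel {x. psi CARD('d) a (mahalanobis_sq \<mu> \<Sigma> x) \<le> v}
    = ennreal (s_const CARD('d) * sqrt (det \<Sigma>) / (real CARD('d) / 2)
        * ((v + a) powr (real CARD('d) / 2) - a powr (real CARD('d) / 2)))"
proof -
  let ?d = "CARD('d)"
  have d: "?d \<ge> 1" by (simp add: Suc_leI)
  have t: "psi_inv ?d a v \<ge> 0" by (simp add: psi_inv_def)
  have "sqrt (psi_inv ?d a v) ^ ?d = psi_inv ?d a v powr (real ?d / 2)"
    using t d by (cases "psi_inv ?d a v = 0")
      (simp_all add: powr_half_sqrt[symmetric] powr_realpow[symmetric] powr_powr)
  moreover have "{x. psi ?d a (mahalanobis_sq \<mu> \<Sigma> x) \<le> v} = {x. mahalanobis_sq \<mu> \<Sigma> x \<le> psi_inv ?d a v}"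
    using psi_le_iff[OF d a mahalanobis_sq_nonneg[OF \<Sigma>] v] by simp
  ultimately show ?thesis
    using emeasure_mahalanobis_le(2)[OF \<Sigma> t] psi_inv_powr[OF d a v] unit_ball_vol_eq_s_const[OF d]
    by (simp add: mult_ac)
qed

lemma distr_psi_mahalanobis:
  fixes \<Sigma> :: "real^'d^'d" and \<mu> :: "real^'d"
  assumes \<Sigma>: "pos_def_matrix \<Sigma>" and a: "a > 0"
  shows "distr lborel borel (\<lambda>x. psi CARD('d) a (mahalanobis_sq \<mu> \<Sigma> x))
    = density lborel (\<lambda>u. ennreal (s_const CARD('d) * sqrt (det \<Sigma>) * (u + a) powr (real CARD('d) / 2 - 1))
        * indicator {0<..} u)" (is "?D = density lborel ?f")
proof -
  let ?d = "CARD('d)"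
  let ?V = "\<lambda>x. psi ?d a (mahalanobis_sq \<mu> \<Sigma> x)"
  let ?c = "s_const ?d * sqrt (det \<Sigma>)"
  let ?p = "real ?d / 2"
  have d: "?d \<ge> 1" by (simp add: Suc_leI)
  have c: "?c \<ge> 0" using s_const_pos[OF d] emeasure_mahalanobis_le(1)[OF \<Sigma> order.refl] by simp
  have V: "?V x \<ge> 0" for x by (intro psi_nonneg d a mahalanobis_sq_nonneg \<Sigma>)
  have D: "emeasure ?D {..v} = emeasure lborel {x. ?V x \<le> v}" for v
    by (subst emeasure_distr) (auto simp: vimage_def)
  have N: "emeasure (density lborel ?f) {..v} = (\<integral>\<^sup>+u. ?f u * indicator {..v} u \<partial>lborel)" for v
    by (subst emeasure_density) auto
  have eq: "emeasure ?D {..v} = emeasure (density lborel ?f) {..v}" for v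
  proof (cases "v \<ge> 0")
    case True
    have "(\<integral>\<^sup>+u. ?f u * indicator {..v} u \<partial>lborel)
        = (\<integral>\<^sup>+u. ennreal (?c * (u + a) powr (?p - 1)) * indicator {0..v} u \<partial>lborel)"
      \<comment> \<open>The density lives on the open half-line, the antiderivative formula on a
        closed interval; they differ by the null set {0}.\<close>
      by (intro nn_integral_cong_AE eventually_mono[OF AE_lborel_singleton[of 0]])
        (auto simp: indicator_def)
    also have "\<dots> = ennreal (?c / ?p * ((v + a) powr ?p - a powr ?p))"
      using a c True d by (intro nn_integral_shifted_powr) auto
    finally show ?thesis
      unfolding D N emeasure_psi_mahalanobis_le[OF \<Sigma> a True] by simp
  next
    case False
    have "?f u * indicator {..v} u = 0" for u using False by (auto simp: indicator_def)
    then have "(\<integral>\<^sup>+u. ?f u * indicator {..v} u \<partial>lborel) = 0" by (simp only: nn_integral_const mult_zero_left)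
    moreover have "{x. ?V x \<le> v} = {}" using V False by (auto simp: not_le intro: less_le_trans)
    ultimately show ?thesis unfolding D N by simp
  qed
  show ?thesis
  \<comment> \<open>Both measures have infinite total mass, so agreement on the intersection-stable
    half-lines is complemented by an exhaustion with half-lines of finite mass.\<close>
  proof (rule measure_eqI_generator_eq[where E = "range atMost" and \<Omega> = UNIV and A = "\<lambda>n. {..real n}"])
    show "Int_stable (range (atMost :: real \<Rightarrow> _))"
      by (auto simp: Int_stable_def)
    show "sets ?D = sigma_sets UNIV (range atMost)"
      "sets (density lborel ?f) = sigma_sets UNIV (range atMost)"
      by (simp_all add: borel_eq_atMost)
    show "emeasure ?D X = emeasure (density lborel ?f) X" if "X \<in> range atMost" for X
      using that eq by auto
    show "(\<Union>n. {..real n}) = UNIV" by (auto intro: real_arch_simple)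
    show "emeasure ?D {..real n} \<noteq> \<infinity>" for n
      unfolding D by (subst emeasure_psi_mahalanobis_le[OF \<Sigma> a]) auto
  qed auto
qed

text \<open>Along the ray from \<open>\<mu>\<close> in a direction \<open>w\<close>, the quadratic
  form at distance parameter s is \<open>q\<close> times the square of s. Evaluating the density at
  parameter \<open>sqrt (t / q)\<close> therefore recovers \<open>g t\<close> for every
  \<open>t \<ge> 0\<close> as a Borel function of \<open>t\<close>.\<close>

lemma elliptical_generator_measurable:
  fixes \<Sigma> :: "real^'d^'d" and \<mu> :: "real^'d"
  assumes \<Sigma>: "pos_def_matrix \<Sigma>" and f: "elliptical_density \<mu> \<Sigma> g \<in> borel_measurable borel"
  obtains G where "G \<in> borel_measurable borel" and "\<And>t. t \<ge> 0 \<Longrightarrow> G t = g t"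
proof -
  let ?A = "matrix_inv \<Sigma>"
  obtain w :: "real^'d" where w: "w \<noteq> 0" by (metis axis_eq_0_iff one_neq_zero)
  define q where "q = w \<bullet> (?A *v w)"
  have q: "q > 0" using pos_def_matrix_inv(2)[OF \<Sigma>] w by (simp add: pos_def_matrix_def q_def)
  define G where "G = (\<lambda>t. det \<Sigma> powr (1 / 2) * elliptical_density \<mu> \<Sigma> g (\<mu> + sqrt (t / q) *\<^sub>R w))"
  have "G t = g t" if "t \<ge> 0" for t
  proof -
    have "mahalanobis_sq \<mu> \<Sigma> (\<mu> + sqrt (t / q) *\<^sub>R w) = (sqrt (t / q) * sqrt (t / q)) * q"
      by (simp only: mahalanobis_sq_def add_diff_cancel_left' matrix_vector_mult_scaleR q_def
          inner_scaleR_left inner_scaleR_right mult.assoc)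
    also have "\<dots> = t" using that q by simp
    finally show ?thesis
      using emeasure_mahalanobis_le(1)[OF \<Sigma> order.refl]
      by (simp add: G_def elliptical_density_def powr_minus mult.assoc[symmetric])
  qed
  moreover have "G \<in> borel_measurable borel"
    unfolding G_def by (intro borel_measurable_times borel_measurable_const measurable_compose[OF _ f]) measurable
  ultimately show thesis using that by blast
qed

proposition distributed_psi_mahalanobis:
  fixes \<Sigma> :: "real^'d^'d" and \<mu> :: "real^'d"
  assumes \<Sigma>: "pos_def_matrix \<Sigma>" and a: "a > 0"
    and f: "elliptical_density \<mu> \<Sigma> g \<in> borel_measurable borel"
    and X: "distributed M lborel X (\<lambda>x. ennreal (elliptical_density \<mu> \<Sigma> g x))"
    and g: "\<And>t. t \<ge> 0 \<Longrightarrow> g t \<ge> 0"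
  shows "distributed M lborel (\<lambda>\<omega>. psi CARD('d) a (mahalanobis_sq \<mu> \<Sigma> (X \<omega>)))
    (\<lambda>v. ennreal (indicator {0<..} v * (s_const CARD('d) * rho CARD('d) g a v)))"
proof -
  let ?d = "CARD('d)"
  let ?V = "\<lambda>x. psi ?d a (mahalanobis_sq \<mu> \<Sigma> x)"
  let ?c = "s_const ?d * sqrt (det \<Sigma>)"
  let ?p = "real ?d / 2"
  have d: "?d \<ge> 1" by (simp add: Suc_leI)
  note m0 = mahalanobis_sq_nonneg[OF \<Sigma>]
  have s: "s_const ?d > 0" by (rule s_const_pos[OF d])
  have det: "det \<Sigma> > 0" by (rule emeasure_mahalanobis_le(1)[OF \<Sigma> order.refl])
  obtain G where [measurable]: "G \<in> borel_measurable borel" and G: "\<And>t. t \<ge> 0 \<Longrightarrow> G t = g t"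
    using elliptical_generator_measurable[OF \<Sigma> f] by blast
  have t0: "psi_inv ?d a v \<ge> 0" for v by (simp add: psi_inv_def)
  let ?r = "\<lambda>v. ennreal (indicator {0<..} v * (s_const ?d * rho ?d g a v))"
  \<comment> \<open>Measurability of the target density comes from this explicit Borel expression,
    in which neither \<open>g\<close> nor the inverse inside \<open>rho\<close> occurs.\<close>
  have r_eq: "?r = (\<lambda>v. ennreal (indicator {0<..} v * (s_const ?d * (G (psi_inv ?d a v) * (v + a) powr (?p - 1)))))"
    by (auto simp: fun_eq_iff indicator_def rho_eq[OF d a] G[OF t0])
  have [measurable]: "?r \<in> borel_measurable borel" unfolding r_eq by measurable
  have [measurable]: "X \<in> borel_measurable M" using distributed_measurable[OF X] by simp
  have "distr M lborel (\<lambda>\<omega>. ?V (X \<omega>)) = density lborel ?r"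
  proof (rule measure_eqI)
    fix S assume "S \<in> sets (distr M lborel (\<lambda>\<omega>. ?V (X \<omega>)))"
    then have [measurable]: "S \<in> sets borel" by simp
    \<comment> \<open>The integrand as a function of V alone: \<open>psi_inv\<close> recovers the
      value of the quadratic form from V, so the known image of Lebesgue measure applies.\<close>
    let ?F = "\<lambda>v. ennreal (det \<Sigma> powr (- 1 / 2) * G (psi_inv ?d a v)) * indicator S v"
    have "emeasure (distr M lborel (\<lambda>\<omega>. ?V (X \<omega>))) S = (\<integral>\<^sup>+\<omega>. indicator S (?V (X \<omega>)) \<partial>M)"
      by (simp add: nn_integral_indicator[symmetric] nn_integral_distr del: nn_integral_indicator)
    also have "\<dots> = (\<integral>\<^sup>+x. ennreal (elliptical_density \<mu> \<Sigma> g x) * indicator S (?V x) \<partial>lborel)"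
      by (rule distributed_nn_integral[OF X, symmetric]) measurable
    also have "\<dots> = (\<integral>\<^sup>+x. ?F (?V x) \<partial>lborel)"
      by (simp add: elliptical_density_def psi_inv_psi[OF d a m0] G m0)
    also have "\<dots> = (\<integral>\<^sup>+v. ?F v \<partial>distr lborel borel ?V)"
      by (rule nn_integral_distr[symmetric]) measurable
    also have "\<dots> = (\<integral>\<^sup>+v. (ennreal (?c * (v + a) powr (?p - 1)) * indicator {0<..} v) * ?F v \<partial>lborel)"
      unfolding distr_psi_mahalanobis[OF \<Sigma> a] by (rule nn_integral_density) measurable
    also have "\<dots> = (\<integral>\<^sup>+v. ?r v * indicator S v \<partial>lborel)"
    proof (rule nn_integral_cong)
      fix v
      have "sqrt (det \<Sigma>) * det \<Sigma> powr (- 1 / 2) = 1"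
        using det by (simp add: powr_half_sqrt[symmetric] powr_add[symmetric])
      moreover have "?c * x * (det \<Sigma> powr (- 1 / 2) * y)
          = s_const ?d * (sqrt (det \<Sigma>) * det \<Sigma> powr (- 1 / 2)) * (y * x)" for x y
        by (simp only: mult_ac)
      ultimately have key: "?c * (v + a) powr (?p - 1) * (det \<Sigma> powr (- 1 / 2) * G (psi_inv ?d a v))
        = s_const ?d * (G (psi_inv ?d a v) * (v + a) powr (?p - 1))"
        by (simp only: mult_1_right)
      have "?c * (v + a) powr (?p - 1) \<ge> 0" using s det by simp
      then have "ennreal (?c * (v + a) powr (?p - 1)) * ennreal (det \<Sigma> powr (- 1 / 2) * G (psi_inv ?d a v))
          = ennreal (s_const ?d * (G (psi_inv ?d a v) * (v + a) powr (?p - 1)))"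
        unfolding key[symmetric] by (rule ennreal_mult'[symmetric])
      then show "(ennreal (?c * (v + a) powr (?p - 1)) * indicator {0<..} v) * ?F v = ?r v * indicator S v"
        by (cases "v > 0") (simp_all add: rho_eq[OF d a] G[OF t0] mult.assoc[symmetric] del: ennreal_eq_0_iff)
    qed
    also have "\<dots> = emeasure (density lborel ?r) S" by (simp add: emeasure_density)
    finally show "emeasure (distr M lborel (\<lambda>\<omega>. ?V (X \<omega>))) S = emeasure (density lborel ?r) S" .
  qed simp
  then show ?thesis by (simp add: distributed_def)
qed

section \<open>Kernel integrals near a point\<close>

text \<open>Used with \<open>\<phi>\<close> an increment of the density or a Taylor remainder. Both
  are controlled only on the support of \<open>L\<close>, which after scaling is a shrinking
  neighbourhood of the point.\<close>

lemma supported_product_bound: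
  fixes L \<phi> :: "real \<Rightarrow> real"
  assumes L: "integrable lborel L" and supp: "\<forall>w. \<bar>w\<bar> > R \<longrightarrow> L w = 0"
    and \<phi>: "\<phi> \<in> borel_measurable borel" and B: "\<forall>w. \<bar>w\<bar> \<le> R \<longrightarrow> \<bar>\<phi> w\<bar> \<le> B"
  shows "integrable lborel (\<lambda>w. L w * \<phi> w)"
    and "\<bar>LINT w|lborel. L w * \<phi> w\<bar> \<le> B * (LINT w|lborel. \<bar>L w\<bar>)"
proof -
  have le: "\<bar>L w * \<phi> w\<bar> \<le> B * \<bar>L w\<bar>" for w
    using B supp mult_right_mono[of "\<bar>\<phi> w\<bar>" B "\<bar>L w\<bar>"]
    by (cases "\<bar>w\<bar> \<le> R") (auto simp: abs_mult mult.commute)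
  have dom: "integrable lborel (\<lambda>w. B * \<bar>L w\<bar>)" using L by simp
  show int: "integrable lborel (\<lambda>w. L w * \<phi> w)"
  proof (rule Bochner_Integration.integrable_bound[OF dom])
    show "(\<lambda>w. L w * \<phi> w) \<in> borel_measurable lborel" using L \<phi> by simp
    show "AE w in lborel. norm (L w * \<phi> w) \<le> norm (B * \<bar>L w\<bar>)"
      using le by (intro AE_I2) (metis abs_ge_self order_trans real_norm_def)
  qed
  have "\<bar>LINT w|lborel. L w * \<phi> w\<bar> \<le> (LINT w|lborel. \<bar>L w * \<phi> w\<bar>)"
    by (rule integral_abs_bound)
  also have "\<dots> \<le> (LINT w|lborel. B * \<bar>L w\<bar>)"
    using int dom le by (intro integral_mono) auto
  also have "\<dots> = B * (LINT w|lborel. \<bar>L w\<bar>)" by simp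
  finally show "\<bar>LINT w|lborel. L w * \<phi> w\<bar> \<le> B * (LINT w|lborel. \<bar>L w\<bar>)" .
qed

text \<open>For \<open>\<bar>w\<bar> \<le> R\<close> the point \<open>y - h n * w\<close> is within
  \<open>h n * \<bar>R\<bar>\<close> of \<open>y\<close>, so continuity at \<open>y\<close> alone
  gives closeness uniformly on the support of \<open>L\<close>. Integrability is only eventual
  because \<open>r\<close> may be unbounded away from \<open>y\<close>.\<close>

lemma scaled_kernel_limit:
  fixes L r :: "real \<Rightarrow> real"
  assumes L: "integrable lborel L" and supp: "\<forall>w. \<bar>w\<bar> > R \<longrightarrow> L w = 0"
    and r: "r \<in> borel_measurable borel" and cont: "isCont r y"
    and h: "\<And>n. h n > 0" "h \<longlonglongrightarrow> 0"
  shows "\<forall>\<^sub>F n in sequentially. integrable lborel (\<lambda>w. L w * r (y - h n * w))"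
    and "(\<lambda>n. LINT w|lborel. L w * r (y - h n * w)) \<longlonglongrightarrow> r y * (LINT w|lborel. L w)"
proof -
  let ?I = "LINT w|lborel. \<bar>L w\<bar>"
  have near: "\<forall>\<^sub>F n in sequentially. \<forall>w. \<bar>w\<bar> \<le> R \<longrightarrow> \<bar>r (y - h n * w) - r y\<bar> \<le> e" if e: "e > 0" for e
  proof -
    obtain \<delta> where \<delta>: "\<delta> > 0" "\<And>x. \<bar>x - y\<bar> < \<delta> \<Longrightarrow> \<bar>r x - r y\<bar> < e"
      using cont e by (auto simp: continuous_at_eps_delta dist_real_def)
    have "(\<lambda>n. h n * \<bar>R\<bar>) \<longlonglongrightarrow> 0" using tendsto_mult_left_zero[OF h(2)] by simp
    then have "\<forall>\<^sub>F n in sequentially. h n * \<bar>R\<bar> < \<delta>" using \<delta>(1) by (rule order_tendstoD)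
    then show ?thesis
    proof eventually_elim
      case (elim n)
      show ?case
      proof (intro allI impI)
        fix w assume "\<bar>w\<bar> \<le> R"
        then have "h n * \<bar>w\<bar> \<le> h n * \<bar>R\<bar>" using h(1)[of n] by (intro mult_left_mono) auto
        also have "\<dots> < \<delta>" by (rule elim)
        finally have "\<bar>(y - h n * w) - y\<bar> < \<delta>" using h(1)[of n] by (simp add: abs_mult)
        then show "\<bar>r (y - h n * w) - r y\<bar> \<le> e" using \<delta>(2) by (simp add: less_imp_le)
      qed
    qed
  qed
  have split: "integrable lborel (\<lambda>w. L w * r (y - h n * w)) \<and>
      \<bar>(LINT w|lborel. L w * r (y - h n * w)) - r y * (LINT w|lborel. L w)\<bar> \<le> e * ?I"
    if le: "\<forall>w. \<bar>w\<bar> \<le> R \<longrightarrow> \<bar>r (y - h n * w) - r y\<bar> \<le> e" for n e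
  proof -
    have m: "(\<lambda>w. r (y - h n * w) - r y) \<in> borel_measurable borel"
      using r by measurable
    note b = supported_product_bound[OF L supp m le]
    note i1 = b(1)
    have i2: "integrable lborel (\<lambda>w. L w * r y)" using L by simp
    have eq: "L w * r (y - h n * w) = L w * (r (y - h n * w) - r y) + L w * r y" for w
      by (simp add: algebra_simps)
    have "(LINT w|lborel. L w * r (y - h n * w))
        = (LINT w|lborel. L w * (r (y - h n * w) - r y)) + (LINT w|lborel. L w) * r y"
      unfolding eq Bochner_Integration.integral_add[OF i1 i2] by simp
    moreover have "integrable lborel (\<lambda>w. L w * r (y - h n * w))"
      unfolding eq using i1 i2 by (rule Bochner_Integration.integrable_add)
    ultimately show ?thesis using b(2) by (simp add: mult.commute)
  qed
  show "\<forall>\<^sub>F n in sequentially. integrable lborel (\<lambda>w. L w * r (y - h n * w))"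
    using near[OF zero_less_one] by eventually_elim (use split in blast)
  show "(\<lambda>n. LINT w|lborel. L w * r (y - h n * w)) \<longlonglongrightarrow> r y * (LINT w|lborel. L w)"
  proof (rule tendstoI)
    fix e :: real assume e: "e > 0"
    have I: "?I \<ge> 0" by (intro integral_nonneg_AE) auto
    \<comment> \<open>Dividing by \<open>J + 1\<close> instead of \<open>J\<close> covers the case
      of a vanishing integral.\<close>
    have "\<exists>e'>0. e' * J < e" if "J \<ge> 0" for J
      using that e by (intro exI[of _ "e / (J + 1)"]) (simp add: field_simps)
    from this[OF I] obtain e' where e': "e' > 0" "e' * ?I < e" by blast
    show "\<forall>\<^sub>F n in sequentially.
        dist (LINT w|lborel. L w * r (y - h n * w)) (r y * (LINT w|lborel. L w)) < e"
      using near[OF e'(1)]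
    proof eventually_elim
      case (elim n)
      from split[OF elim] e'(2) show ?case by (simp add: dist_real_def)
    qed
  qed
qed

text \<open>The derivative of order \<open>m + 1\<close> is continuous, hence bounded on a compact
  ball around \<open>y\<close>; this bounds the Lagrange remainder uniformly.\<close>

lemma taylor_bound:
  assumes "cont_diff_near (Suc m) f y"
  obtains \<delta> C where "\<delta> > 0" "C \<ge> 0"
    "\<And>x. \<bar>x - y\<bar> \<le> \<delta> \<Longrightarrow>
      \<bar>f x - (\<Sum>j\<le>m. (deriv ^^ j) f y / fact j * (x - y) ^ j)\<bar> \<le> C * \<bar>x - y\<bar> ^ Suc m"
proof -
  obtain U where U: "open U" "y \<in> U"
    and diff: "\<And>j x. j < Suc m \<Longrightarrow> x \<in> U \<Longrightarrow> (deriv ^^ j) f differentiable (at x)"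
    and cont: "continuous_on U ((deriv ^^ Suc m) f)"
    using assms unfolding cont_diff_near_def by blast
  obtain \<delta> where \<delta>: "\<delta> > 0" "cball y \<delta> \<subseteq> U" using U open_contains_cball by blast
  have mem: "x \<in> U" if "\<bar>x - y\<bar> \<le> \<delta>" for x using that \<delta>(2) by (auto simp: dist_real_def abs_minus_commute)
  have "compact ((deriv ^^ Suc m) f ` cball y \<delta>)"
    using continuous_on_subset[OF cont \<delta>(2)] by (intro compact_continuous_image) auto
  then obtain B where B: "B > 0" "\<And>x. x \<in> cball y \<delta> \<Longrightarrow> \<bar>(deriv ^^ Suc m) f x\<bar> \<le> B"
    using compact_imp_bounded bounded_pos by (metis (no_types, lifting) image_eqI real_norm_def)
  define C where "C = B / fact (Suc m)"
  have "\<bar>f x - (\<Sum>j\<le>m. (deriv ^^ j) f y / fact j * (x - y) ^ j)\<bar> \<le> C * \<bar>x - y\<bar> ^ Suc m"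
    if x: "\<bar>x - y\<bar> \<le> \<delta>" for x
  proof (cases "x = y")
    case True
    have "(\<Sum>j\<le>m. (deriv ^^ j) f y / fact j * (y - y) ^ j) = f y"
      by (subst sum.atMost_shift) simp
    with True show ?thesis by simp
  next
    case False
    have D: "\<forall>j t. j < Suc m \<and> y - \<delta> \<le> t \<and> t \<le> y + \<delta> \<longrightarrow>
        ((deriv ^^ j) f has_real_derivative (deriv ^^ Suc j) f t) (at t)"
    proof (intro allI impI)
      fix j t assume "j < Suc m \<and> y - \<delta> \<le> t \<and> t \<le> y + \<delta>"
      then show "((deriv ^^ j) f has_real_derivative (deriv ^^ Suc j) f t) (at t)"
        using diff[of j t] mem[of t] by (auto simp: DERIV_deriv_iff_real_differentiable abs_le_iff)
    qed
    obtain t where t: "if x < y then x < t \<and> t < y else y < t \<and> t < x"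
      and eq: "f x = (\<Sum>j<Suc m. (deriv ^^ j) f y / fact j * (x - y) ^ j)
        + (deriv ^^ Suc m) f t / fact (Suc m) * (x - y) ^ Suc m"
      using Taylor[of "Suc m" "\<lambda>j. (deriv ^^ j) f" f "y - \<delta>" "y + \<delta>" y x] D x \<delta>(1) False
      by (auto simp: abs_le_iff)
    have "t \<in> cball y \<delta>" using t x by (auto simp: dist_real_def split: if_splits)
    then have "\<bar>(deriv ^^ Suc m) f t\<bar> \<le> B" by (rule B(2))
    then have "\<bar>(deriv ^^ Suc m) f t / fact (Suc m) * (x - y) ^ Suc m\<bar> \<le> C * \<bar>x - y\<bar> ^ Suc m"
      unfolding C_def abs_mult power_abs by (intro mult_right_mono) (auto simp: divide_right_mono)
    then show ?thesis unfolding eq lessThan_Suc_atMost by simp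
  qed
  moreover have "C \<ge> 0" using B(1) by (simp add: C_def)
  ultimately show thesis using that \<delta>(1) by blast
qed

text \<open>Only the moments of order \<open>k\<close> and \<open>m\<close> survive. In the first,
  the sign of \<open>(- h) ^ k\<close> cancels the sign in the normalisation of the kernel; in the
  second, the sign \<open>(- 1) ^ m\<close> stays.\<close>

lemma kernel_taylor_integral:
  assumes K: "kernel_of_order k m K" and km: "k < m"
  shows "integrable lborel (\<lambda>w. K w * (\<Sum>j\<le>m. c j / fact j * (- h * w) ^ j))" (is ?int)
    and "(LINT w|lborel. K w * (\<Sum>j\<le>m. c j / fact j * (- h * w) ^ j))
      = h ^ k * c k + (- 1) ^ m * kernel_moment m K * (h ^ m / fact m) * c m" (is ?eq)
proof -
  have eq: "K w * (\<Sum>j\<le>m. c j / fact j * (- h * w) ^ j)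
      = (\<Sum>j\<le>m. c j / fact j * (- h) ^ j * (K w * w ^ j))" for w
    unfolding power_mult_distrib sum_distrib_left by (intro sum.cong) (simp_all add: mult_ac)
  have int: "integrable lborel (\<lambda>w. c j / fact j * (- h) ^ j * (K w * w ^ j))" if "j \<le> m" for j
    using K that by (intro integrable_mult_right) (auto simp: kernel_of_order_def)
  show ?int unfolding eq using int by (intro Bochner_Integration.integrable_sum) auto
  have "(LINT w|lborel. K w * (\<Sum>j\<le>m. c j / fact j * (- h * w) ^ j))
      = (\<Sum>j\<le>m. c j / fact j * (- h) ^ j * kernel_moment j K)"
    unfolding eq kernel_moment_def using int by (subst Bochner_Integration.integral_sum) auto
  also have "\<dots> = (\<Sum>j\<in>{k, m}. c j / fact j * (- h) ^ j * kernel_moment j K)"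
    using K km by (intro sum.mono_neutral_right) (auto simp: kernel_of_order_def)
  also have "\<dots> = c k / fact k * (- h) ^ k * ((- 1) ^ k * fact k) + c m / fact m * (- h) ^ m * kernel_moment m K"
    using K km by (simp add: kernel_of_order_def)
  also have "\<dots> = h ^ k * c k + (- 1) ^ m * kernel_moment m K * (h ^ m / fact m) * c m"
  proof -
    have "(- h) ^ k * (- 1) ^ k = h ^ k" by (simp flip: power_mult_distrib)
    moreover have "(- h) ^ m = (- 1) ^ m * h ^ m" by (rule power_minus)
    ultimately show ?thesis by (simp add: mult_ac)
  qed
  finally show ?eq .
qed

text \<open>Two functions appear because \<open>r\<close> is to be the truncated density, measurable
  on the whole line, while the derivatives are those of \<open>f\<close>, untruncated; they agree
  near \<open>y\<close>.\<close>

proposition kernel_bias_bound: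
  fixes K r f :: "real \<Rightarrow> real"
  assumes K: "kernel_of_order k m K" and km: "k < m"
    and supp: "\<forall>w. \<bar>w\<bar> > R \<longrightarrow> K w = 0"
    and r: "r \<in> borel_measurable borel" and rf: "\<forall>\<^sub>F x in nhds y. r x = f x"
    and smooth: "cont_diff_near (Suc m) f y"
    and h: "\<And>n. h n > 0" "h \<longlonglongrightarrow> 0"
  obtains B where "\<forall>\<^sub>F n in sequentially.
    \<bar>(LINT w|lborel. K w * r (y - h n * w)) -
      (h n ^ k * (deriv ^^ k) f y + (- 1) ^ m * kernel_moment m K * (h n ^ m / fact m) * (deriv ^^ m) f y)\<bar>
    \<le> B * h n ^ Suc m"
proof -
  obtain \<delta> C where \<delta>: "\<delta> > 0" and C: "C \<ge> 0"
    and taylor: "\<And>x. \<bar>x - y\<bar> \<le> \<delta> \<Longrightarrow>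
      \<bar>f x - (\<Sum>j\<le>m. (deriv ^^ j) f y / fact j * (x - y) ^ j)\<bar> \<le> C * \<bar>x - y\<bar> ^ Suc m"
    using taylor_bound[OF smooth] by blast
  obtain \<epsilon> where \<epsilon>: "\<epsilon> > 0" "\<And>x. \<bar>x - y\<bar> < \<epsilon> \<Longrightarrow> r x = f x"
    using rf by (auto simp: eventually_nhds_metric dist_real_def)
  have "integrable lborel (\<lambda>w. K w * w ^ 0)" using K unfolding kernel_of_order_def by blast
  then have KI: "integrable lborel K" by simp
  let ?I = "LINT w|lborel. \<bar>K w\<bar>"
  let ?T = "\<lambda>h w. \<Sum>j\<le>m. (deriv ^^ j) f y / fact j * (- h * w) ^ j"
  have "(\<lambda>n. h n * \<bar>R\<bar>) \<longlonglongrightarrow> 0" using tendsto_mult_left_zero[OF h(2)] by simp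
  \<comment> \<open>Below \<open>\<delta>\<close> the Taylor bound applies on the whole support,
    below \<open>\<epsilon>\<close> the functions \<open>r\<close> and \<open>f\<close> coincide
    there.\<close>
  then have "\<forall>\<^sub>F n in sequentially. h n * \<bar>R\<bar> < min \<delta> \<epsilon>"
    using \<delta> \<epsilon>(1) by (intro order_tendstoD(2)) auto
  then have "\<forall>\<^sub>F n in sequentially.
    \<bar>(LINT w|lborel. K w * r (y - h n * w)) -
      (h n ^ k * (deriv ^^ k) f y + (- 1) ^ m * kernel_moment m K * (h n ^ m / fact m) * (deriv ^^ m) f y)\<bar>
    \<le> (C * \<bar>R\<bar> ^ Suc m * ?I) * h n ^ Suc m"
  proof eventually_elim
    case (elim n)
    have meas: "(\<lambda>w. r (y - h n * w) - ?T (h n) w) \<in> borel_measurable borel"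
      using r by measurable
    have le: "\<forall>w. \<bar>w\<bar> \<le> R \<longrightarrow> \<bar>r (y - h n * w) - ?T (h n) w\<bar> \<le> C * (h n * \<bar>R\<bar>) ^ Suc m"
    proof (intro allI impI)
      fix w assume that: "\<bar>w\<bar> \<le> R"
      have "h n * \<bar>w\<bar> \<le> h n * \<bar>R\<bar>" using that h(1)[of n] by (intro mult_left_mono) auto
      then have hw: "\<bar>(y - h n * w) - y\<bar> \<le> h n * \<bar>R\<bar>" using h(1)[of n] by (simp add: abs_mult)
      then have "\<bar>f (y - h n * w) - (\<Sum>j\<le>m. (deriv ^^ j) f y / fact j * ((y - h n * w) - y) ^ j)\<bar>
          \<le> C * \<bar>(y - h n * w) - y\<bar> ^ Suc m"
        using elim by (intro taylor) auto
      also have "\<dots> \<le> C * (h n * \<bar>R\<bar>) ^ Suc m"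
        using hw C by (intro mult_left_mono power_mono) auto
      also have "f (y - h n * w) = r (y - h n * w)"
        using hw elim by (intro \<epsilon>(2)[symmetric]) auto
      finally show "\<bar>r (y - h n * w) - ?T (h n) w\<bar> \<le> C * (h n * \<bar>R\<bar>) ^ Suc m" by simp
    qed
    note b = supported_product_bound[OF KI supp meas le]
    note t = kernel_taylor_integral[OF K km, where c = "\<lambda>j. (deriv ^^ j) f y" and h = "h n"]
    have eq: "K w * r (y - h n * w) = K w * (r (y - h n * w) - ?T (h n) w) + K w * ?T (h n) w" for w
      by (simp add: algebra_simps)
    have "(LINT w|lborel. K w * r (y - h n * w))
      = (LINT w|lborel. K w * (r (y - h n * w) - ?T (h n) w)) + (LINT w|lborel. K w * ?T (h n) w)"
      by (subst eq, rule Bochner_Integration.integral_add[OF b(1) t(1)])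
    then show ?case
      using b(2) unfolding t(2) by (simp add: power_mult_distrib mult_ac)
  qed
  then show thesis by (rule that)
qed

section \<open>Moments of sums and of one summand\<close>

context prob_space
begin

lemma variance_add_indep:
  fixes A B :: "'a \<Rightarrow> real"
  assumes ind: "indep_var borel A borel B"
    and A: "integrable M A" "integrable M (\<lambda>\<omega>. (A \<omega>)\<^sup>2)"
    and B: "integrable M B" "integrable M (\<lambda>\<omega>. (B \<omega>)\<^sup>2)"
  shows "integrable M (\<lambda>\<omega>. (A \<omega> + B \<omega>)\<^sup>2)"
    and "variance (\<lambda>\<omega>. A \<omega> + B \<omega>) = variance A + variance B"
proof -
  have AB: "integrable M (\<lambda>\<omega>. A \<omega> * B \<omega>)"
    by (rule indep_var_integrable[OF ind A(1) B(1)])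
  have sq: "(A \<omega> + B \<omega>)\<^sup>2 = (A \<omega>)\<^sup>2 + (B \<omega>)\<^sup>2 + 2 * (A \<omega> * B \<omega>)" for \<omega>
    by (simp add: power2_sum)
  show int: "integrable M (\<lambda>\<omega>. (A \<omega> + B \<omega>)\<^sup>2)"
    unfolding sq using A B AB by (intro Bochner_Integration.integrable_add integrable_mult_right)
  have E: "expectation (\<lambda>\<omega>. (A \<omega> + B \<omega>)\<^sup>2)
      = expectation (\<lambda>\<omega>. (A \<omega>)\<^sup>2) + expectation (\<lambda>\<omega>. (B \<omega>)\<^sup>2) + 2 * (expectation A * expectation B)"
    unfolding sq using A B AB indep_var_lebesgue_integral[OF ind A(1) B(1)] by simp
  have S: "integrable M (\<lambda>\<omega>. A \<omega> + B \<omega>)" using A(1) B(1) by simp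
  show "variance (\<lambda>\<omega>. A \<omega> + B \<omega>) = variance A + variance B"
    unfolding variance_eq[OF S int] variance_eq[OF A] variance_eq[OF B] E
    using A(1) B(1) by (simp add: power2_sum)
qed

lemma variance_sum_indep:
  fixes Z :: "'i \<Rightarrow> 'a \<Rightarrow> real"
  assumes "finite I" and "indep_vars (\<lambda>_. borel) Z I"
    and "\<And>i. i \<in> I \<Longrightarrow> integrable M (Z i)" and "\<And>i. i \<in> I \<Longrightarrow> integrable M (\<lambda>\<omega>. (Z i \<omega>)\<^sup>2)"
  shows "integrable M (\<lambda>\<omega>. (\<Sum>i\<in>I. Z i \<omega>)\<^sup>2)
    \<and> variance (\<lambda>\<omega>. \<Sum>i\<in>I. Z i \<omega>) = (\<Sum>i\<in>I. variance (Z i))"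
  using assms
proof (induction I rule: finite_induct)
  case empty
  show ?case by simp
next
  case (insert i I)
  have IH: "integrable M (\<lambda>\<omega>. (\<Sum>i\<in>I. Z i \<omega>)\<^sup>2)"
    "variance (\<lambda>\<omega>. \<Sum>i\<in>I. Z i \<omega>) = (\<Sum>i\<in>I. variance (Z i))"
    using insert.IH indep_vars_subset[OF insert.prems(1)] insert.prems(2,3) by auto
  have ind: "indep_var borel (Z i) borel (\<lambda>\<omega>. \<Sum>i\<in>I. Z i \<omega>)"
    by (rule indep_vars_sum[OF insert.hyps insert.prems(1)])
  have S: "integrable M (\<lambda>\<omega>. \<Sum>i\<in>I. Z i \<omega>)" using insert.prems(2) by auto
  show ?case
    using variance_add_indep[OF ind insert.prems(2)[OF insertI1] insert.prems(3)[OF insertI1] S IH(1)]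
      insert.hyps IH(2) by simp
qed



lemma scaled_iid_sum_moments:
  fixes Z :: "nat \<Rightarrow> 'a \<Rightarrow> real"
  assumes ind: "indep_vars (\<lambda>_. borel) Z {1..n}"
    and Z: "\<And>i. i \<in> {1..n} \<Longrightarrow> integrable M (Z i)"
    and Z2: "\<And>i. i \<in> {1..n} \<Longrightarrow> integrable M (\<lambda>\<omega>. (Z i \<omega>)\<^sup>2)"
    and e: "\<And>i. i \<in> {1..n} \<Longrightarrow> expectation (Z i) = e"
    and q: "\<And>i. i \<in> {1..n} \<Longrightarrow> expectation (\<lambda>\<omega>. (Z i \<omega>)\<^sup>2) = q"
  shows "integrable M (\<lambda>\<omega>. c * (\<Sum>i=1..n. Z i \<omega>))"
    and "integrable M (\<lambda>\<omega>. (c * (\<Sum>i=1..n. Z i \<omega>))\<^sup>2)"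
    and "expectation (\<lambda>\<omega>. c * (\<Sum>i=1..n. Z i \<omega>)) = c * (real n * e)"
    and "variance (\<lambda>\<omega>. c * (\<Sum>i=1..n. Z i \<omega>)) = c\<^sup>2 * (real n * (q - e\<^sup>2))"
proof -
  have S: "integrable M (\<lambda>\<omega>. \<Sum>i=1..n. Z i \<omega>)" using Z by auto
  note v = variance_sum_indep[OF finite_atLeastAtMost ind Z Z2]
  show 1: "integrable M (\<lambda>\<omega>. c * (\<Sum>i=1..n. Z i \<omega>))" using S by (rule integrable_mult_right)
  show 2: "integrable M (\<lambda>\<omega>. (c * (\<Sum>i=1..n. Z i \<omega>))\<^sup>2)"
    unfolding power_mult_distrib using v by (intro integrable_mult_right) auto
  have "expectation (\<lambda>\<omega>. \<Sum>i=1..n. Z i \<omega>) = real n * e"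
    using Z e by (simp add: Bochner_Integration.integral_sum)
  then show 3: "expectation (\<lambda>\<omega>. c * (\<Sum>i=1..n. Z i \<omega>)) = c * (real n * e)" by simp
  have vi: "variance (Z i) = q - e\<^sup>2" if "i \<in> {1..n}" for i
    using variance_eq[OF Z[OF that] Z2[OF that]] e[OF that] q[OF that] by simp
  have "(\<Sum>i=1..n. variance (Z i)) = (\<Sum>i=1..n. q - e\<^sup>2)" by (intro sum.cong refl vi)
  also have "\<dots> = real n * (q - e\<^sup>2)" by simp
  finally have "(\<Sum>i=1..n. variance (Z i)) = real n * (q - e\<^sup>2)" .
  then have var: "variance (\<lambda>\<omega>. \<Sum>i=1..n. Z i \<omega>) = real n * (q - e\<^sup>2)" using v by simp
  have "(c * (\<Sum>i=1..n. Z i \<omega>) - expectation (\<lambda>\<omega>. c * (\<Sum>i=1..n. Z i \<omega>)))\<^sup>2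
      = c\<^sup>2 * ((\<Sum>i=1..n. Z i \<omega>) - expectation (\<lambda>\<omega>. \<Sum>i=1..n. Z i \<omega>))\<^sup>2" for \<omega>
    by (simp flip: right_diff_distrib power_mult_distrib)
  then show "variance (\<lambda>\<omega>. c * (\<Sum>i=1..n. Z i \<omega>)) = c\<^sup>2 * (real n * (q - e\<^sup>2))"
    by (simp add: var del: One_nat_def)
qed

text \<open>The substitution \<open>v = y - h * w\<close> has slope \<open>- h\<close>, hence the
  factor \<open>h\<close>. It is applied to the kernel for the mean and to its square for the second
  moment.\<close>

lemma expectation_kernel_at:
  fixes V :: "'a \<Rightarrow> real" and L r :: "real \<Rightarrow> real"
  assumes V: "distributed M lborel V (\<lambda>v. ennreal (s * r v))"
    and r: "\<And>v. r v \<ge> 0" and s: "s \<ge> 0" and h: "h > 0"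
    and L: "L \<in> borel_measurable borel"
    and int: "integrable lborel (\<lambda>w. L w * r (y - h * w))"
  shows "integrable M (\<lambda>\<omega>. L ((y - V \<omega>) / h))"
    and "expectation (\<lambda>\<omega>. L ((y - V \<omega>) / h)) = s * h * (LINT w|lborel. L w * r (y - h * w))"
proof -
  let ?f = "\<lambda>v. s * r v * L ((y - v) / h)"
  have f: "?f (y + (- h) * w) = s * (L w * r (y - h * w))" for w
    using h by simp
  have m: "(\<lambda>v. L ((y - v) / h)) \<in> borel_measurable lborel" using L by measurable
  have nn: "\<And>v. s * r v \<ge> 0" using r s by simp
  have "integrable lborel ?f \<longleftrightarrow> integrable lborel (\<lambda>w. ?f (y + (- h) * w))"
    using h by (intro lborel_integrable_real_affine_iff[symmetric]) auto
  then have "integrable lborel ?f" unfolding f using int by simp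
  then show "integrable M (\<lambda>\<omega>. L ((y - V \<omega>) / h))"
    using distributed_integrable[OF V m] nn by simp
  have "expectation (\<lambda>\<omega>. L ((y - V \<omega>) / h)) = (LINT v|lborel. ?f v)"
    using distributed_integral[OF V m] nn by simp
  also have "\<dots> = \<bar>- h\<bar> *\<^sub>R (LINT w|lborel. ?f (y + (- h) * w))"
    using h by (intro lborel_integral_real_affine) auto
  also have "\<dots> = s * h * (LINT w|lborel. L w * r (y - h * w))"
    unfolding f using h by simp
  finally show "expectation (\<lambda>\<omega>. L ((y - V \<omega>) / h)) = s * h * (LINT w|lborel. L w * r (y - h * w))" .
qed

end

section \<open>Bias and variance of the estimator\<close>

lemma cont_diff_near_isCont:
  assumes "cont_diff_near k f y"
  shows "isCont f y"
proof -
  obtain U where U: "open U" "y \<in> U" and diff: "\<forall>j<k. \<forall>x\<in>U. (deriv ^^ j) f differentiable (at x)"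
    and cont: "continuous_on U ((deriv ^^ k) f)"
    using assms unfolding cont_diff_near_def by blast
  show ?thesis
  proof (cases k)
    case 0
    then show ?thesis using cont U by (simp add: continuous_on_eq_continuous_at)
  next
    case (Suc k')
    then have "f differentiable (at y)" using diff U by force
    then show ?thesis by (rule differentiable_imp_continuous_within)
  qed
qed

text \<open>A vanishing integral would make \<open>K\<close> zero almost everywhere, contradicting
  the nonzero moment of order \<open>m\<close>.\<close>

lemma kernel_square_integral_pos:
  assumes K: "kernel_of_order k m K" and K2: "integrable lborel (\<lambda>w. (K w)\<^sup>2)"
  shows "(LINT w|lborel. (K w)\<^sup>2) > 0"
proof -
  have "(LINT w|lborel. (K w)\<^sup>2) \<noteq> 0"
  proof
    assume "(LINT w|lborel. (K w)\<^sup>2) = 0"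
    then have "AE w in lborel. (K w)\<^sup>2 = 0"
      using integral_nonneg_eq_0_iff_AE[OF K2] by simp
    then have "AE w in lborel. K w * w ^ m = 0" by eventually_elim simp
    then have "kernel_moment m K = 0" unfolding kernel_moment_def by (rule integral_eq_zero_AE)
    then show False using K by (simp add: kernel_of_order_def)
  qed
  moreover have "(LINT w|lborel. (K w)\<^sup>2) \<ge> 0" by simp
  ultimately show ?thesis by linarith
qed

text \<open>One summand has mean \<open>s * h * e\<close> and second moment
  \<open>s * h * q\<close>. After normalisation the squared mean keeps an extra factor
  \<open>h\<close>, which makes it negligible against \<open>q\<close>.\<close>

lemma estimator_constants:
  fixes s h e q :: real
  assumes "s > 0" "h > 0" "n \<ge> 1"
  shows "1 / (real n * h ^ (k + 1) * s) * (real n * (s * h * e)) = e / h ^ k"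
    and "(1 / (real n * h ^ (k + 1) * s))\<^sup>2 * (real n * (s * h * q - (s * h * e)\<^sup>2))
      = 1 / (real n * h ^ (2 * k + 1) * s) * (q - s * h * e\<^sup>2)"
proof -
  have "real n > 0" "h ^ k > 0" using assms by simp_all
  moreover have "h ^ (2 * k + 1) = h * (h ^ k)\<^sup>2" by (simp add: power_mult mult.commute flip: power_mult)
  ultimately show "1 / (real n * h ^ (k + 1) * s) * (real n * (s * h * e)) = e / h ^ k"
    and "(1 / (real n * h ^ (k + 1) * s))\<^sup>2 * (real n * (s * h * q - (s * h * e)\<^sup>2))
      = 1 / (real n * h ^ (2 * k + 1) * s) * (q - s * h * e\<^sup>2)"
    using assms by (simp_all add: field_simps power2_eq_square)
qed

text \<open>The sign \<open>(- 1) ^ m\<close> stems from expanding at \<open>y - h n * w\<close>.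
  The remainder order \<open>m - k + 1\<close> is obtained from a continuous derivative of order
  \<open>m + 1\<close>. The variance constant is the density factor at \<open>y\<close>, that is
  \<open>z_fun\<close> at \<open>\<xi>\<close>; if it were 0, the equivalence would force the
  variance to vanish eventually. Integrability is asserted explicitly, since the integral of a
  non-integrable function is 0 by convention.\<close>

theorem proposition3p1:
  fixes M :: "'w measure"
    and \<mu> :: "real ^ 'd" and \<Sigma> :: "real ^ 'd ^ 'd"
    and g :: "real \<Rightarrow> real" and X :: "nat \<Rightarrow> 'w \<Rightarrow> real ^ 'd"
    and a \<xi> :: real and k m :: nat and K :: "real \<Rightarrow> real" and h :: "nat \<Rightarrow> real"
  defines "\<rho> \<equiv> rho CARD('d) g a"
    and "y \<equiv> psi CARD('d) a \<xi>"
    and "\<eta> \<equiv> (\<lambda>n. eta_hat \<mu> \<Sigma> k K a X n (h n) \<xi>)"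
  assumes Sigma: "pos_def_matrix \<Sigma>"
    and g_nonneg: "\<And>t. t \<ge> 0 \<Longrightarrow> g t \<ge> 0"
    and density: "prob_density (elliptical_density \<mu> \<Sigma> g)"
    and prob: "prob_space M"
    and indep: "prob_space.indep_vars M (\<lambda>_. borel) X {1..}"
    and distr: "\<And>i. i \<ge> 1 \<Longrightarrow>
      distributed M lborel (X i) (\<lambda>x. ennreal (elliptical_density \<mu> \<Sigma> g x))"
    and a_pos: "a > 0"
    and km: "m \<ge> k + 2" "even (m - k)"
    and kernel: "kernel_of_order k m K"
    and K_sq: "integrable lborel (\<lambda>w. (K w)\<^sup>2)"
    and K_supp: "compact (closure {w. K w \<noteq> 0})"
    and xi_pos: "\<xi> > 0"
    and smooth: "cont_diff_near k \<rho> y"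
    and h_pos: "\<And>n. h n > 0"
    and h_lim: "h \<longlonglongrightarrow> 0"
  shows "(\<forall>\<^sub>F n in sequentially. integrable M (\<eta> n) \<and> integrable M (\<lambda>\<omega>. (\<eta> n \<omega>)\<^sup>2)) \<and>
    (cont_diff_near (m + 1) \<rho> y \<longrightarrow>
      (\<lambda>n. prob_space.expectation M (\<eta> n) -
           ((deriv ^^ k) \<rho> y +
            (- 1) ^ m * kernel_moment m K * (h n ^ (m - k) / fact m) * (deriv ^^ m) \<rho> y))
        \<in> O(\<lambda>n. h n ^ (m - k + 1))) \<and>
    (g \<xi> > 0 \<longrightarrow>
      (\<lambda>n. prob_space.variance M (\<eta> n)) \<sim>[sequentially]
      (\<lambda>n. z_fun CARD('d) g a \<xi> * (LINT w|lborel. (K w)\<^sup>2) /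
           (real n * h n ^ (2 * k + 1) * s_const CARD('d))))"
proof -
  interpret prob_space M by (rule prob)
  let ?d = "CARD('d)"
  let ?s = "s_const ?d"
  define V where "V = (\<lambda>i \<omega>. psi ?d a (mahalanobis_sq \<mu> \<Sigma> (X i \<omega>)))"
  define r where "r = (\<lambda>v. indicator {0<..} v * \<rho> v)"
  have d: "?d \<ge> 1" by (simp add: Suc_leI)
  have s: "?s > 0" by (rule s_const_pos[OF d])
  have y: "y > 0" unfolding y_def by (rule psi_pos[OF d a_pos xi_pos])
  have V0: "V i \<omega> \<ge> 0" for i \<omega>
    unfolding V_def by (rule psi_nonneg[OF d a_pos mahalanobis_sq_nonneg[OF Sigma]])
  have f: "elliptical_density \<mu> \<Sigma> g \<in> borel_measurable borel"
    using density by (simp add: prob_density_def)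
  have r0: "r v \<ge> 0" for v
    using g_nonneg by (simp add: r_def \<rho>_def rho_eq[OF d a_pos] psi_inv_def indicator_def)
  have V_distr: "distributed M lborel (V i) (\<lambda>v. ennreal (?s * r v))" if "i \<ge> 1" for i
    using distributed_psi_mahalanobis[OF Sigma a_pos f distr[OF that] g_nonneg]
    by (simp add: V_def r_def \<rho>_def mult.left_commute)
  \<comment> \<open>Measurability of \<open>r\<close> is read off the density of V, which carries it
    by definition, and then freed of the constant factor.\<close>
  have "(\<lambda>v. ?s * r v) \<in> borel_measurable borel"
    using distributed_real_measurable[OF _ V_distr[OF order.refl]] r0 s by simp
  then have "(\<lambda>v. ?s * r v / ?s) \<in> borel_measurable borel"
    by (rule borel_measurable_divide[OF _ borel_measurable_const])
  moreover have "(\<lambda>v. ?s * r v / ?s) = r" using s by (simp add: fun_eq_iff)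
  ultimately have r_meas: "r \<in> borel_measurable borel" by (simp only:)
  have r_near: "\<forall>\<^sub>F x in nhds y. r x = \<rho> x"
    using eventually_nhds_in_open[of "{0<..}" y] y
    by (auto simp: r_def elim!: eventually_mono)
  have r_cont: "isCont r y"
    using cont_diff_near_isCont[OF smooth] isCont_cong[OF r_near] by blast
  have ry: "r y = z_fun ?d g a \<xi>"
    using y rho_psi[OF d a_pos xi_pos, of g] by (simp add: r_def \<rho>_def y_def)

  have "bounded {w. K w \<noteq> 0}"
    using K_supp by (meson bounded_subset closure_subset compact_imp_bounded)
  then obtain R where R: "R > 0" and "\<forall>w\<in>{w. K w \<noteq> 0}. norm w \<le> R"
    by (auto simp: bounded_pos)
  then have K_out: "\<forall>w. \<bar>w\<bar> > R \<longrightarrow> K w = 0" by force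
  have "integrable lborel (\<lambda>w. K w * w ^ 0)" using kernel unfolding kernel_of_order_def by blast
  then have K_int: "integrable lborel K" by simp
  then have K_meas [measurable]: "K \<in> borel_measurable borel" by auto
  have K2_out: "\<forall>w. \<bar>w\<bar> > R \<longrightarrow> (K w)\<^sup>2 = 0" using K_out by simp
  define e where "e = (\<lambda>n. LINT w|lborel. K w * r (y - h n * w))"
  define q where "q = (\<lambda>n. LINT w|lborel. (K w)\<^sup>2 * r (y - h n * w))"
  note e_lim = scaled_kernel_limit[OF K_int K_out r_meas r_cont h_pos h_lim, folded e_def]
  note q_lim = scaled_kernel_limit[OF K_sq K2_out r_meas r_cont h_pos h_lim, folded q_def]

  have "(\<lambda>n. h n * R) \<longlonglongrightarrow> 0" using tendsto_mult_left_zero[OF h_lim] by simp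
  then have "\<forall>\<^sub>F n in sequentially. h n * R < y" using y by (rule order_tendstoD)
  \<comment> \<open>\<open>n \<ge> 1\<close> is required for the factor \<open>1 / real n\<close> to
    cancel the number of summands; at \<open>n = 0\<close> it is 0 by convention.\<close>
  then have moments: "\<forall>\<^sub>F n in sequentially.
      integrable M (\<eta> n) \<and> integrable M (\<lambda>\<omega>. (\<eta> n \<omega>)\<^sup>2) \<and> expectation (\<eta> n) = e n / h n ^ k \<and>
      variance (\<eta> n) = 1 / (real n * h n ^ (2 * k + 1) * ?s) * (q n - ?s * h n * (e n)\<^sup>2)"
    using e_lim(1) q_lim(1) eventually_ge_at_top[of 1]
  proof eventually_elim
    case (elim n)
    define Z where "Z = (\<lambda>i \<omega>. K ((y - V i \<omega>) / h n))"
    define c where "c = 1 / (real n * h n ^ (k + 1) * ?s)"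
    have reflected: "K ((y + V i \<omega>) / h n) = 0" for i \<omega>
    proof -
      have "R < (y + V i \<omega>) / h n"
        using elim(1) V0[of i \<omega>] h_pos[of n] by (simp add: pos_less_divide_eq mult.commute)
      then show ?thesis using K_out by (metis abs_ge_self less_le_trans)
    qed
    have \<eta>: "\<eta> n = (\<lambda>\<omega>. c * (\<Sum>i=1..n. Z i \<omega>))"
      using reflected by (simp add: fun_eq_iff \<eta>_def eta_hat_def c_def Z_def V_def y_def)
    have "indep_vars (\<lambda>_. borel) X {1..n}"
      by (rule indep_vars_subset[OF indep]) auto
    then have ind: "indep_vars (\<lambda>_. borel) Z {1..n}"
      unfolding Z_def V_def
      by (rule indep_vars_compose2[where Y = "\<lambda>i x. K ((y - psi ?d a (mahalanobis_sq \<mu> \<Sigma> x)) / h n)"])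
        measurable
    have Z: "integrable M (Z i)" "expectation (Z i) = ?s * h n * e n" if "i \<in> {1..n}" for i
      unfolding Z_def e_def using that elim(2) s
      by (auto intro!: expectation_kernel_at[OF V_distr r0 _ h_pos K_meas])
    have Z2: "integrable M (\<lambda>\<omega>. (Z i \<omega>)\<^sup>2)" "expectation (\<lambda>\<omega>. (Z i \<omega>)\<^sup>2) = ?s * h n * q n"
      if "i \<in> {1..n}" for i
      unfolding Z_def q_def using that elim(3) s
      by (auto intro!: expectation_kernel_at[where L = "\<lambda>w. (K w)\<^sup>2", OF V_distr r0 _ h_pos])
    note S = scaled_iid_sum_moments[OF ind, where e = "?s * h n * e n" and q = "?s * h n * q n" and c = c]
    have "integrable M (\<eta> n)" unfolding \<eta> by (rule S(1)) (fact Z Z2)+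
    moreover have "integrable M (\<lambda>\<omega>. (\<eta> n \<omega>)\<^sup>2)" unfolding \<eta> by (rule S(2)) (fact Z Z2)+
    moreover have "expectation (\<eta> n) = c * (real n * (?s * h n * e n))"
      unfolding \<eta> by (rule S(3)) (fact Z Z2)+
    then have "expectation (\<eta> n) = e n / h n ^ k"
      unfolding c_def estimator_constants(1)[OF s h_pos elim(4)] .
    moreover have "variance (\<eta> n) = c\<^sup>2 * (real n * (?s * h n * q n - (?s * h n * e n)\<^sup>2))"
      unfolding \<eta> by (rule S(4)) (fact Z Z2)+
    then have "variance (\<eta> n) = 1 / (real n * h n ^ (2 * k + 1) * ?s) * (q n - ?s * h n * (e n)\<^sup>2)"
      unfolding c_def estimator_constants(2)[OF s h_pos elim(4)] .
    ultimately show ?case by blast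
  qed

  have bias: "(\<lambda>n. expectation (\<eta> n) - ((deriv ^^ k) \<rho> y +
      (- 1) ^ m * kernel_moment m K * (h n ^ (m - k) / fact m) * (deriv ^^ m) \<rho> y))
      \<in> O(\<lambda>n. h n ^ (m - k + 1))" if smooth': "cont_diff_near (m + 1) \<rho> y"
  proof -
    have km': "k < m" using km by simp
    have smooth'': "cont_diff_near (Suc m) \<rho> y" using smooth' by simp
    obtain B where B: "\<forall>\<^sub>F n in sequentially.
      \<bar>e n - (h n ^ k * (deriv ^^ k) \<rho> y
        + (- 1) ^ m * kernel_moment m K * (h n ^ m / fact m) * (deriv ^^ m) \<rho> y)\<bar> \<le> B * h n ^ Suc m"
      unfolding e_def
      by (rule kernel_bias_bound[OF kernel km' K_out r_meas r_near smooth'' h_pos h_lim])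
    show ?thesis
    proof (rule bigoI[of _ B])
      show "\<forall>\<^sub>F n in sequentially. norm (expectation (\<eta> n) - ((deriv ^^ k) \<rho> y +
          (- 1) ^ m * kernel_moment m K * (h n ^ (m - k) / fact m) * (deriv ^^ m) \<rho> y))
          \<le> B * norm (h n ^ (m - k + 1))"
        using B moments
      proof eventually_elim
        case (elim n)
        have hk: "h n ^ k > 0" using h_pos by simp
        have pw: "h n ^ m = h n ^ k * h n ^ (m - k)" "h n ^ Suc m = h n ^ k * h n ^ (m - k + 1)"
          using km' by (simp_all flip: power_add)
        let ?D = "expectation (\<eta> n) - ((deriv ^^ k) \<rho> y +
          (- 1) ^ m * kernel_moment m K * (h n ^ (m - k) / fact m) * (deriv ^^ m) \<rho> y)"
        \<comment> \<open>The bias bound concerns \<open>e n\<close>, so the deviation is multiplied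
          by \<open>h n ^ k\<close> and the positive factor is cancelled at the end.\<close>
        have "e n = h n ^ k * expectation (\<eta> n)" using elim(2) h_pos[of n] by simp
        then have "e n - (h n ^ k * (deriv ^^ k) \<rho> y
            + (- 1) ^ m * kernel_moment m K * (h n ^ m / fact m) * (deriv ^^ m) \<rho> y) = h n ^ k * ?D"
          unfolding pw(1) by (simp add: algebra_simps)
        then have "h n ^ k * \<bar>?D\<bar> \<le> h n ^ k * (B * h n ^ (m - k + 1))"
          using elim(1) hk unfolding pw(2) by (simp add: abs_mult mult.left_commute)
        then have "\<bar>?D\<bar> \<le> B * h n ^ (m - k + 1)" using hk by (simp only: mult_le_cancel_left_pos)
        then show ?case using h_pos[of n] by simp
      qed
    qed
  qed

  have var: "(\<lambda>n. variance (\<eta> n)) \<sim>[sequentially] (\<lambda>n. z_fun ?d g a \<xi> * (LINT w|lborel. (K w)\<^sup>2) /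
      (real n * h n ^ (2 * k + 1) * ?s))" if g: "g \<xi> > 0"
  proof -
    let ?L = "z_fun ?d g a \<xi> * (LINT w|lborel. (K w)\<^sup>2)"
    have "a powr (real ?d / 2) + \<xi> powr (real ?d / 2) > 0"
      using a_pos xi_pos by (intro add_pos_pos) auto
    then have "z_fun ?d g a \<xi> > 0"
      unfolding z_fun_eq[OF d a_pos xi_pos] using g by (intro mult_pos_pos) auto
    then have L: "?L \<noteq> 0" using kernel_square_integral_pos[OF kernel K_sq] by simp
    \<comment> \<open>Since \<open>e n\<close> converges, the factor \<open>h n\<close> removes the
      squared mean and leaves the limit of \<open>q n\<close>.\<close>
    have "(\<lambda>n. q n - ?s * h n * (e n)\<^sup>2) \<longlonglongrightarrow> ?L - ?s * 0 * (r y * (LINT w|lborel. K w))\<^sup>2"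
      using q_lim(2) e_lim(2) h_lim unfolding ry[symmetric] by (intro tendsto_intros)
    then have lim: "(\<lambda>n. q n - ?s * h n * (e n)\<^sup>2) \<sim>[sequentially] (\<lambda>_. ?L)"
      using L by (intro tendsto_imp_asymp_equiv_const) simp_all
    \<comment> \<open>The prefactor is identical on both sides, so only the bracket has to be
      compared with its nonzero limit.\<close>
    have "(\<lambda>n. 1 / (real n * h n ^ (2 * k + 1) * ?s) * (q n - ?s * h n * (e n)\<^sup>2))
        \<sim>[sequentially] (\<lambda>n. 1 / (real n * h n ^ (2 * k + 1) * ?s) * ?L)"
      by (rule asymp_equiv_mult[OF asymp_equiv_refl lim])
    then show ?thesis
      using moments by (elim asymp_equiv_transfer) (auto elim!: eventually_mono)
  qed

  show ?thesis
    using moments bias var by (auto elim!: eventually_mono)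
qed

end
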